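(* Let $d\ge 1$, $m>0$, $\varkappa>0$, $0\le a\in L^1(\mathbb{R}^d)$ with $\int_{\mathbb{R}^d}a(x)\,dx=1$, let $E$ be one of the spaces $C_{ub}(\mathbb{R}^d)$, $C_b(\mathbb{R}^d)$, $L^\infty(\mathbb{R}^d)$, and let $G:E\to E$. Assume: (1) $\beta:=\varkappa-m>0$; (2) there exists $\theta>0$ such that $0=G0\le Gv\le G\theta=\beta$ for all $v\in E_\theta^+$; (3) there exists $l_\theta>0$ such that $\|Gv-Gw\|_E\le l_\theta\|v-w\|_E$ for all $v,w\in E_\theta^+$; (4) for some $p\ge 0$ and all $v,w\in E_\theta^+$ with $v\le w$, one has $\varkappa\, a*v-v\,Gv+pv\le \varkappa\, a*w-w\,Gw+pw$; (5) there exists $\varrho>0$ such that $a(x)\ge\varrho$ for a.a. $x\in B_\varrho(0)$; (6) for any $v_n,v\in E_\theta^+$ such that $v_n\to v$ locally uniformly, one has $Gv_n\to Gv$ locally uniformly; (7) $T_yGv=GT_yv$ for all $v\in E_\theta^+$, $y\in\mathbb{R}^d$; (8) $Gr<\beta$ for every constant $r\in(0,\theta)$ (by (7), $Gr$ is a constant function); (9) $\int_{\mathbb{R}^d}|y|\,a(y)\,dy<\infty$; (10) there exist $q\ge0$, $\delta>0$ and $0\le b\in C^\infty(\mathbb{R}^d)\cap L^\infty(\mathbb{R}^d)$ such that $a(x)-b(x)\ge\delta\,\mathbf 1_{B_\delta(0)}(x)$ for $x\in\mathbb{R}^d$, and $w\,Gw\le\varkappa\, b*w+qw$ for all $w\in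 E_\theta^+$. Set $\mathfrak m:=\varkappa\int_{\mathbb{R}^d}x\,a(x)\,dx\in\mathbb{R}^d$. Let $u_0\in E_\theta^+$, $u_0\not\equiv0$, and let $u$ be the corresponding solution to $$\frac{\partial u}{\partial t}(x,t)=\varkappa(a*u)(x,t)-m\,u(x,t)-u(x,t)(Gu)(x,t),\quad t>0,\qquad u(x,0)=u_0(x).$$ Then, for any compact set $K\subset\mathbb{R}^d$, $$\lim_{t\to\infty}\operatorname*{ess\,inf}_{x\in K}u(x+t\mathfrak m,t)=\theta .$$
   Context: $C_{ub}(\mathbb{R}^d)$ and $C_b(\mathbb{R}^d)$ are the spaces of bounded uniformly continuous, respectively bounded continuous, real functions with the sup-norm; $L^\infty(\mathbb{R}^d)$ has the esssup-norm. Inequalities between elements of $E$ are pointwise (a.e. if $E=L^\infty$). For $r>0$, $E_r^+:=\{v\in E:0\le v\le r\}$. Constants are identified with constant functions. $(a*u)(x,t)=\int_{\mathbb{R}^d}a(x-y)u(y,t)\,dy$; $(Gu)(x,t)$ means $(G u(\cdot,t))(x)$; $(T_yv)(x)=v(x-y)$; $B_r(x_0)$ is the ball of radius $r$ centered at $x_0$. Locally uniform convergence means uniform convergence on compact subsets of $\mathbb{R}^d$. A classical solution on $\mathbb{R}_+=[0,\infty)$ is a function $u\in C([0,\infty)\to E)\cap C^1((0,\infty)\to E)$ which satisfies the equation for $t>0$ and $u(\cdot,0)=u_0$ in $E$. Under (1)–(4), for every $u_0\in E_\theta^+$ there is a unique classical solution on $\mathbb{R}_+$ with $0\le u(x,t)\le\theta$;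 this is "the corresponding solution". The condition $u_0\not\equiv0$: if $E$ consists of continuous functions, $u_0$ is not identically zero; if $E=L^\infty(\mathbb{R}^d)$, it means that there exist $\delta>0$ and $x_0\in\mathbb{R}^d$ such that $u_0(x)\ge\delta$ for a.a. $x\in B_\delta(x_0)$. *)

theory Defs
  imports "HOL-Analysis.Analysis" "HOL-Probability.Essential_Supremum"
begin

text \<open>
  The three admissible spaces \<open>E\<close>. Elements of \<open>E\<close> are represented by functions; for \<open>Linf\<close>
  these are representatives of classes modulo null sets, so equality and order in \<open>E\<close> are
  \<open>eq_in\<close> and \<open>le_in\<close> below (pointwise, or almost everywhere for \<open>Linf\<close>), and operators on
  \<open>E\<close> are required to respect \<open>eq_in\<close> (\<open>maps_space\<close>).
\<close>

datatype space_kind = Cub | Cb | Linf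

fun space_of :: "space_kind \<Rightarrow> ('a::euclidean_space \<Rightarrow> real) set" where
  "space_of Cub = {f. bounded (range f) \<and> uniformly_continuous_on UNIV f}"
| "space_of Cb = {f. bounded (range f) \<and> continuous_on UNIV f}"
| "space_of Linf = {f \<in> borel_measurable lebesgue. \<exists>C. AE x in lebesgue. \<bar>f x\<bar> \<le> C}"

fun norm_in :: "space_kind \<Rightarrow> ('a::euclidean_space \<Rightarrow> real) \<Rightarrow> real" where
  "norm_in Cub f = (SUP x. \<bar>f x\<bar>)"
| "norm_in Cb f = (SUP x. \<bar>f x\<bar>)"
| "norm_in Linf f = real_of_ereal (esssup lebesgue (\<lambda>x. ereal \<bar>f x\<bar>))"

fun forall_in :: "space_kind \<Rightarrow> ('a::euclidean_space \<Rightarrow> bool) \<Rightarrow> bool" where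
  "forall_in Cub P \<longleftrightarrow> (\<forall>x. P x)"
| "forall_in Cb P \<longleftrightarrow> (\<forall>x. P x)"
| "forall_in Linf P \<longleftrightarrow> (AE x in lebesgue. P x)"

definition eq_in :: "space_kind \<Rightarrow> ('a::euclidean_space \<Rightarrow> real) \<Rightarrow> ('a \<Rightarrow> real) \<Rightarrow> bool" where
  "eq_in E v w \<longleftrightarrow> forall_in E (\<lambda>x. v x = w x)"

definition le_in :: "space_kind \<Rightarrow> ('a::euclidean_space \<Rightarrow> real) \<Rightarrow> ('a \<Rightarrow> real) \<Rightarrow> bool" where
  "le_in E v w \<longleftrightarrow> forall_in E (\<lambda>x. v x \<le> w x)"

definition maps_space ::
    "space_kind \<Rightarrow> (('a::euclidean_space \<Rightarrow> real) \<Rightarrow> ('a \<Rightarrow> real)) \<Rightarrow> bool" where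
  "maps_space E G \<longleftrightarrow>
     (\<forall>v\<in>space_of E. G v \<in> space_of E) \<and>
     (\<forall>v\<in>space_of E. \<forall>w\<in>space_of E. eq_in E v w \<longrightarrow> eq_in E (G v) (G w))"

definition Eplus :: "space_kind \<Rightarrow> real \<Rightarrow> ('a::euclidean_space \<Rightarrow> real) set" where
  "Eplus E r = {v \<in> space_of E. le_in E (\<lambda>_. 0) v \<and> le_in E v (\<lambda>_. r)}"

definition loc_unif_conv ::
    "space_kind \<Rightarrow> (nat \<Rightarrow> 'a::euclidean_space \<Rightarrow> real) \<Rightarrow> ('a \<Rightarrow> real) \<Rightarrow> bool" where
  "loc_unif_conv E vn v \<longleftrightarrow>
     (\<forall>K. compact K \<longrightarrow>
        (\<forall>e>0. \<forall>\<^sub>F n in sequentially. forall_in E (\<lambda>x. x \<in> K \<longrightarrow> \<bar>vn n x - v x\<bar> < e)))"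

definition not_identically_zero :: "space_kind \<Rightarrow> ('a::euclidean_space \<Rightarrow> real) \<Rightarrow> bool" where
  "not_identically_zero E v \<longleftrightarrow>
     (if E = Linf
      then \<exists>\<delta>>0. \<exists>x0. AE x in lebesgue. x \<in> ball x0 \<delta> \<longrightarrow> v x \<ge> \<delta>
      else \<exists>x. v x \<noteq> 0)"

definition translate :: "'a::euclidean_space \<Rightarrow> ('a \<Rightarrow> real) \<Rightarrow> ('a \<Rightarrow> real)" where
  "translate y v = (\<lambda>x. v (x - y))"

definition conv :: "('a::euclidean_space \<Rightarrow> real) \<Rightarrow> ('a \<Rightarrow> real) \<Rightarrow> ('a \<Rightarrow> real)" where
  "conv a v = (\<lambda>x. \<integral>y. a (x - y) * v y \<partial>lebesgue)"

primrec Ck :: "nat \<Rightarrow> ('a::euclidean_space \<Rightarrow> real) \<Rightarrow> bool" where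
  "Ck 0 f \<longleftrightarrow> continuous_on UNIV f"
| "Ck (Suc k) f \<longleftrightarrow>
     (\<forall>x. f differentiable at x) \<and> (\<forall>h. Ck k (\<lambda>x. frechet_derivative f (at x) h))"

definition smooth :: "('a::euclidean_space \<Rightarrow> real) \<Rightarrow> bool" where
  "smooth f \<longleftrightarrow> (\<forall>k. Ck k f)"

definition continuous_into ::
    "space_kind \<Rightarrow> real set \<Rightarrow> (real \<Rightarrow> 'a::euclidean_space \<Rightarrow> real) \<Rightarrow> bool" where
  "continuous_into E S u \<longleftrightarrow>
     (\<forall>t\<in>S. u t \<in> space_of E) \<and>
     (\<forall>t\<in>S. ((\<lambda>s. norm_in E (\<lambda>x. u s x - u t x)) \<longlongrightarrow> 0) (at t within S))"

definition has_derivative_into ::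
    "space_kind \<Rightarrow> (real \<Rightarrow> 'a::euclidean_space \<Rightarrow> real) \<Rightarrow> ('a \<Rightarrow> real) \<Rightarrow> real \<Rightarrow> bool" where
  "has_derivative_into E u w t \<longleftrightarrow>
     ((\<lambda>h. norm_in E (\<lambda>x. (u (t + h) x - u t x) / h - w x)) \<longlongrightarrow> 0) (at 0)"

text \<open>The solution is curried with time first: \<open>u t x\<close> stands for $u(x,t)$.\<close>

definition classical_solution ::
    "space_kind \<Rightarrow> real \<Rightarrow> real \<Rightarrow> ('a::euclidean_space \<Rightarrow> real) \<Rightarrow>
     (('a \<Rightarrow> real) \<Rightarrow> ('a \<Rightarrow> real)) \<Rightarrow> ('a \<Rightarrow> real) \<Rightarrow> (real \<Rightarrow> 'a \<Rightarrow> real) \<Rightarrow> bool" where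
  "classical_solution E \<kappa> m a G u0 u \<longleftrightarrow>
     continuous_into E {0..} u \<and>
     (\<exists>u'. continuous_into E {0<..} u' \<and>
           (\<forall>t>0. has_derivative_into E u (u' t) t) \<and>
           (\<forall>t>0. eq_in E (u' t) (\<lambda>x. \<kappa> * conv a (u t) x - m * u t x - u t x * G (u t) x))) \<and>
     eq_in E (u 0) u0"

definition drift :: "real \<Rightarrow> ('a::euclidean_space \<Rightarrow> real) \<Rightarrow> 'a" where
  "drift \<kappa> a = \<kappa> *\<^sub>R (\<integral>x. a x *\<^sub>R x \<partial>lebesgue)"

text \<open>Essential infimum over \<open>K\<close>; as for any infimum over the empty set, it is \<open>\<infinity>\<close> for null sets \<open>K\<close>.\<close>

definition ess_inf_on :: "'a::euclidean_space set \<Rightarrow> ('a \<Rightarrow> real) \<Rightarrow> ereal" where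
  "ess_inf_on K f = - esssup (restrict_space lebesgue K) (\<lambda>x. - ereal (f x))"

end

theory Submission imports Defs begin

text \<open>
  \<^bold>\<open>Why the theorem holds.\<close> Put \<open>M = m + p\<close> and \<open>F v = \<kappa> a*v - v Gv + p v\<close>, so that the equation
  reads \<open>u' = F u - M u\<close> with a monotone \<open>F\<close>. Integrating this over a short time interval gives an
  explicit lower bound (\<open>sol_step\<close>): if \<open>w \<le> u t\<close>, then
  \<open>z w + h z F (z w) \<le> u (t + h)\<close>, where \<open>z = 1 - M h\<close>. Hence no comparison principle and no
  auxiliary solution is needed: the solution is bounded from below by iterating this one-step bound
  on explicit barriers, namely multiples and translates of the truncated paraboloid
  \<open>max 0 (1 - |x|\<^sup>2 / L\<^sup>2)\<close>. The argument rests on three facts.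

  \<^item> Positivity (\<open>positive_on_ball\<close>). Since \<open>w Gw\<close> is dominated by \<open>\<kappa> b*w + q w\<close>, the operator \<open>F\<close> is
    bounded from below by an average over balls of a fixed radius. A paraboloid that lies
    below the solution may therefore be replaced by a lower one on a larger ball, and
    finitely many replacements, made in an arbitrarily short time, reach any ball.

  \<^item> Growth (\<open>paraboloid_growth\<close>, \<open>persists_some\<close>). For \<open>0 \<le> w \<le> r\<close> the Lipschitz bound gives
    \<open>w Gw \<le> l r w\<close>, so small barriers obey a linear equation with the growth rate
    \<open>\<gamma> = \<beta> - l r > 0\<close>. Consider a paraboloid of large radius \<open>L\<close> that moves with the drift. The
    tangent plane of the paraboloid, averaged with \<open>a\<close>, reproduces it up to the
    drift. The curvature error is \<open>o(1/L)\<close>, by dominated convergence with the first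
    moment of \<open>a\<close> only, and the discretization of the drift costs \<open>O(h\<^sup>2/L)\<close> per step. Where the
    paraboloid is at least of order \<open>1/L\<close>, the growth \<open>h \<gamma>\<close> pays for this. Near its edge the tangent plane is
    negative, of order \<open>1/L\<close>, at the points reached by jumps that point outwards, whereas the
    paraboloid is nonnegative there, which is a gain of order \<open>h/L\<close>. So for small \<open>h\<close> and then large
    \<open>L\<close> the amplitude is multiplied by a factor larger than 1 in each step, until it reaches a
    level \<open>r\<close> that does not depend on \<open>L\<close>.

  \<^item> Saturation (\<open>persists_step\<close>, \<open>persists_below_theta\<close>). Let \<open>s\<close> be the supremum of the levels that the solution
    eventually reaches on every ball in the moving frame, and suppose \<open>s < \<theta>\<close>. On a fixed ball
    a paraboloid of huge radius and height \<open>r\<close> is nearly the constant \<open>r\<close>, so that, by the locally uniform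
    continuity of \<open>G\<close>, one time step acts on it nearly as on this constant. By translation
    invariance \<open>G s\<close> is a constant, and it is smaller than \<open>\<beta>\<close>; hence a step raises each level
    close to \<open>s\<close> by a fixed factor, which contradicts the choice of \<open>s\<close>.

  All inequalities between elements of \<open>E\<close> are treated almost everywhere; for continuous functions
  this is the same as everywhere.
\<close>

section \<open>Lebesgue measure and the spaces of functions\<close>

lemma lebesgue_distr_reflect_translate:
  fixes t :: "'a::euclidean_space"
  assumes "\<bar>c\<bar> = 1"
  shows "distr lebesgue lebesgue (\<lambda>x. t + c *\<^sub>R x) = lebesgue"
    and "(\<lambda>x. t + c *\<^sub>R x) \<in> lebesgue \<rightarrow>\<^sub>M lebesgue"
proof -
  have c: "c \<noteq> 0" using assms by auto
  have T: "(\<lambda>x. t + (\<Sum>j\<in>Basis. (c * (x \<bullet> j)) *\<^sub>R j)) = (\<lambda>x. t + c *\<^sub>R x)"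
    unfolding scaleR_scaleR[symmetric] scaleR_sum_right[symmetric] euclidean_representation ..
  show "distr lebesgue lebesgue (\<lambda>x. t + c *\<^sub>R x) = lebesgue"
    using lebesgue_affine_euclidean[of "\<lambda>_. c" t] c assms by (simp add: T density_1)
  show "(\<lambda>x. t + c *\<^sub>R x) \<in> lebesgue \<rightarrow>\<^sub>M lebesgue"
    using lebesgue_affine_measurable[of "\<lambda>_. c" t] c by (simp add: T)
qed

lemma measurable_lebesgue_shift [measurable]:
  fixes y :: "'a::euclidean_space"
  shows "(\<lambda>x. y - x) \<in> lebesgue \<rightarrow>\<^sub>M lebesgue" "(\<lambda>x. x - y) \<in> lebesgue \<rightarrow>\<^sub>M lebesgue"
    "(\<lambda>x. x + y) \<in> lebesgue \<rightarrow>\<^sub>M lebesgue"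
  using lebesgue_distr_reflect_translate(2)[of "-1" y] lebesgue_distr_reflect_translate(2)[of 1 "-y"]
    lebesgue_distr_reflect_translate(2)[of 1 y]
  by (simp_all add: add.commute)

lemma AE_lebesgue_shift:
  fixes y :: "'a::euclidean_space"
  assumes "AE x in lebesgue. P x"
  shows "AE x in lebesgue. P (y - x)" "AE x in lebesgue. P (x - y)" "AE x in lebesgue. P (x + y)"
proof -
  have *: "AE x in lebesgue. P (t + c *\<^sub>R x)" if "\<bar>c\<bar> = 1" for t c
    using AE_distrD[OF lebesgue_distr_reflect_translate(2)[OF that], of P t] assms
    unfolding lebesgue_distr_reflect_translate(1)[OF that] by simp
  show "AE x in lebesgue. P (y - x)" "AE x in lebesgue. P (x - y)" "AE x in lebesgue. P (x + y)"
    using *[of "-1" y] *[of 1 "-y"] *[of 1 y] by (simp_all add: add.commute)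
qed

lemma lebesgue_integral_reflect:
  fixes f :: "'a::euclidean_space \<Rightarrow> real"
  assumes "f \<in> borel_measurable lebesgue"
  shows "(\<integral>y. f (x - y) \<partial>lebesgue) = (\<integral>y. f y \<partial>lebesgue)"
proof -
  have "(\<integral>y. f (x + (-1) *\<^sub>R y) \<partial>lebesgue) =
      integral\<^sup>L (distr lebesgue lebesgue (\<lambda>y. x + (-1) *\<^sub>R y)) f"
    by (rule integral_distr[symmetric, OF lebesgue_distr_reflect_translate(2) assms]) simp
  also have "distr lebesgue lebesgue (\<lambda>y. x + (-1) *\<^sub>R y) = lebesgue"
    by (rule lebesgue_distr_reflect_translate(1)) simp
  finally show ?thesis by simp
qed

lemma conv_commute:
  fixes a v :: "'a::euclidean_space \<Rightarrow> real"
  assumes [measurable]: "a \<in> borel_measurable lebesgue" "v \<in> borel_measurable lebesgue"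
  shows "conv a v x = (\<integral>y. a y * v (x - y) \<partial>lebesgue)"
proof -
  have "(\<lambda>y. a y * v (x - y)) \<in> borel_measurable lebesgue"
    by measurable
  from lebesgue_integral_reflect[OF this, of x] show ?thesis
    unfolding conv_def by simp
qed

lemma conv_scaled_translate:
  fixes a v :: "'a::euclidean_space \<Rightarrow> real"
  assumes [measurable]: "a \<in> borel_measurable lebesgue" "v \<in> borel_measurable lebesgue"
  shows "conv a (\<lambda>x. c * v (x - y)) x = c * conv a v (x - y)"
proof -
  have "(\<lambda>x. c * v (x - y)) \<in> borel_measurable lebesgue" by measurable
  then have "conv a (\<lambda>x. c * v (x - y)) x = (\<integral>y'. a y' * (c * v (x - y' - y)) \<partial>lebesgue)"
    by (rule conv_commute[OF assms(1)])
  also have "\<dots> = (\<integral>y'. c * (a y' * v (x - y - y')) \<partial>lebesgue)"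
    by (intro Bochner_Integration.integral_cong) (simp_all add: algebra_simps)
  also have "\<dots> = c * conv a v (x - y)"
    by (simp add: conv_commute[OF assms])
  finally show ?thesis .
qed

lemma integrable_reflect:
  fixes f :: "'a::euclidean_space \<Rightarrow> real"
  assumes "integrable lebesgue f"
  shows "integrable lebesgue (\<lambda>y. f (x - y))"
proof -
  have "integrable (distr lebesgue lebesgue (\<lambda>y. x + (-1) *\<^sub>R y)) f"
    using assms lebesgue_distr_reflect_translate(1)[of "-1" x] by simp
  then show ?thesis
    using integrable_distr[OF lebesgue_distr_reflect_translate(2)[of "-1" x]] by simp
qed

lemma integrable_mult_AE_bounded:
  fixes a v :: "'a::euclidean_space \<Rightarrow> real"
  assumes "integrable lebesgue a" "v \<in> borel_measurable lebesgue" "AE y in lebesgue. \<bar>v y\<bar> \<le> C"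
  shows "integrable lebesgue (\<lambda>y. a y * v y)"
proof (rule Bochner_Integration.integrable_bound)
  show "integrable lebesgue (\<lambda>y. C * a y)" using assms by simp
  show "AE y in lebesgue. norm (a y * v y) \<le> norm (C * a y)"
    using assms(3)
  proof eventually_elim
    case (elim y)
    then show ?case
      unfolding real_norm_def abs_mult using mult_left_mono[of "\<bar>v y\<bar>" "\<bar>C\<bar>" "\<bar>a y\<bar>"]
      by (simp add: mult.commute)
  qed
qed (use assms in measurable)

lemma integrable_mult_bounded:
  fixes a v :: "'a::euclidean_space \<Rightarrow> real"
  assumes "integrable lebesgue a" "v \<in> borel_measurable lebesgue" "\<And>y. \<bar>v y\<bar> \<le> C"
  shows "integrable lebesgue (\<lambda>y. a y * v y)"
  using assms by (intro integrable_mult_AE_bounded[of a v C]) simp_all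

lemma measure_lebesgue_ball:
  fixes c :: "'a::euclidean_space"
  assumes "0 < r"
  shows "measure lebesgue (ball c r) = measure lebesgue (ball (0::'a) r)" "0 < measure lebesgue (ball c r)"
  using assms by (simp_all add: content_ball)

lemma AE_lebesgue_const:
  assumes "AE x in (lebesgue :: 'a::euclidean_space measure). P"
  shows P
proof (rule ccontr)
  assume "\<not> P"
  then have "AE x in (lborel :: 'a measure). False" using assms by (simp add: AE_completion_iff)
  moreover have "\<not> (AE x in (lborel :: 'a measure). False)"
    by (simp add: AE_iff_null null_sets_def)
  ultimately show False by blast
qed

text \<open>
  Time derivatives in \<open>L\<^sup>\<infinity>\<close> are norm limits and give no pointwise information, so functions are
  compared through their integrals over sets of finite measure.
\<close>

lemma AE_le_if_integral_le:
  fixes v w :: "'a::euclidean_space \<Rightarrow> real"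
  assumes [measurable]: "v \<in> borel_measurable lebesgue" "w \<in> borel_measurable lebesgue"
    and bv: "AE x in lebesgue. \<bar>v x\<bar> \<le> C" and bw: "AE x in lebesgue. \<bar>w x\<bar> \<le> C"
    and le: "\<And>A. A \<in> lmeasurable \<Longrightarrow>
      (\<integral>x. indicator A x * v x \<partial>lebesgue) \<le> (\<integral>x. indicator A x * w x \<partial>lebesgue)"
  shows "AE x in lebesgue. v x \<le> w x"
proof -
  have "AE x in lebesgue. x \<in> ball 0 (real n) \<longrightarrow> v x \<le> w x" for n
  proof -
    define A where "A = {x. w x < v x} \<inter> ball 0 (real n)"
    have "{x \<in> space lebesgue. w x < v x} \<in> sets lebesgue" by measurable
    then have "{x. w x < v x} \<in> sets lebesgue" by simp
    then have Am[measurable]: "A \<in> sets lebesgue"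
      unfolding A_def by (rule sets.Int) (rule fmeasurableD[OF lmeasurable_ball])
    have A: "A \<in> lmeasurable"
      by (rule fmeasurableI2[OF lmeasurable_ball _ Am]) (auto simp: A_def)
    have int: "integrable lebesgue (\<lambda>x. indicator A x * f x)"
      if [measurable]: "f \<in> borel_measurable lebesgue" and "AE x in lebesgue. \<bar>f x\<bar> \<le> C"
      for f :: "'a \<Rightarrow> real"
    proof (rule Bochner_Integration.integrable_bound)
      show "integrable lebesgue (\<lambda>x. C * indicator A x)"
        using fmeasurableD2[OF A]
        by (intro integrable_mult_right integrable_real_indicator Am) (simp add: less_top)
      show "AE x in lebesgue. norm (indicator A x * f x) \<le> norm (C * indicator A x)"
        using that(2) by eventually_elim (auto simp: indicator_def)
    qed measurable
    have i: "integrable lebesgue (\<lambda>x. indicator A x * v x)" "integrable lebesgue (\<lambda>x. indicator A x * w x)"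
      using int bv bw by auto
    have d: "integrable lebesgue (\<lambda>x. indicator A x * v x - indicator A x * w x)"
      using i by (rule Bochner_Integration.integrable_diff)
    have nn: "0 \<le> indicator A x * v x - indicator A x * w x" for x
      by (auto simp: A_def indicator_def)
    have "(\<integral>x. indicator A x * v x - indicator A x * w x \<partial>lebesgue) \<le> 0"
      using le[OF A] by (simp add: Bochner_Integration.integral_diff[OF i])
    moreover have "0 \<le> (\<integral>x. indicator A x * v x - indicator A x * w x \<partial>lebesgue)"
      using nn by simp
    ultimately have "(\<integral>x. indicator A x * v x - indicator A x * w x \<partial>lebesgue) = 0" by linarith
    then have "AE x in lebesgue. indicator A x * v x - indicator A x * w x = 0"
      using integral_nonneg_eq_0_iff_AE[OF d] nn by simp
    then show ?thesis
      by eventually_elim (auto simp: A_def indicator_def split: if_splits)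
  qed
  then have "AE x in lebesgue. \<forall>n. x \<in> ball 0 (real n) \<longrightarrow> v x \<le> w x"
    unfolding AE_all_countable by (rule allI)
  then show ?thesis
  proof eventually_elim
    case (elim x)
    obtain n where "norm x < real n" using reals_Archimedean2 by blast
    then show ?case using elim by auto
  qed
qed

text \<open>
  The exceptional null set may depend on the translation vector; Fubini's theorem
  provides one point \<open>x\<close> for which \<open>f (x - y) = f x\<close> holds for almost all \<open>y\<close>.
\<close>

lemma AE_const_if_translation_invariant:
  fixes f :: "'a::euclidean_space \<Rightarrow> real"
  assumes f: "f \<in> borel_measurable lebesgue"
    and inv: "\<And>y. AE x in lebesgue. f (x - y) = f x"
  shows "\<exists>c. AE x in lebesgue. f x = c"
proof -
  obtain g where g[measurable]: "g \<in> borel_measurable borel" and fg: "AE x in lebesgue. f x = g x"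
    using completion_ex_borel_measurable_real[OF f] by (auto simp: AE_completion_iff)
  have inv': "AE x in lborel. g (x - y) = g x" for y
  proof -
    have "AE x in lebesgue. g (x - y) = g x"
      using inv[of y] fg AE_lebesgue_shift(2)[OF fg, of y] by eventually_elim simp
    then show ?thesis by (simp add: AE_completion_iff)
  qed
  have "AE y in lborel. AE x in lborel. g (x - y) = g x"
    using inv' by simp
  then have "AE x in lborel. AE y in lborel. g (x - y) = g x"
    by (subst (asm) lborel_pair.AE_commute) measurable
  moreover have "\<not> (AE x in (lborel :: 'a measure). False)"
    by (simp add: AE_iff_null null_sets_def)
  ultimately obtain x where x: "AE y in lborel. g (x - y) = g x"
    using eventually_mono by (smt (verit, best))
  then have "AE y in lebesgue. g (x - y) = g x" by (simp add: AE_completion_iff)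
  from AE_lebesgue_shift(1)[OF this, of x] have "AE z in lebesgue. g z = g x" by simp
  with fg have "AE z in lebesgue. f z = g x" by eventually_elim simp
  then show ?thesis by blast
qed

lemma AE_le_imp_le_continuous:
  fixes v w :: "'a::euclidean_space \<Rightarrow> real"
  assumes "continuous_on UNIV v" "continuous_on UNIV w" "AE x in lebesgue. v x \<le> w x"
  shows "v x \<le> w x"
proof (rule ccontr)
  assume x: "\<not> v x \<le> w x"
  let ?A = "{x. w x < v x}"
  have "x \<in> ?A" using x by simp
  have "open ?A" using assms by (intro open_Collect_less) auto
  moreover have "?A \<noteq> {}" using \<open>x \<in> ?A\<close> by blast
  ultimately have "\<not> negligible ?A" using open_not_negligible by blast
  moreover have "?A \<in> null_sets lebesgue"
  proof -
    have "?A \<in> sets lebesgue" using \<open>open ?A\<close> by auto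
    moreover have "AE x in lebesgue. x \<notin> ?A" using assms(3) by eventually_elim auto
    ultimately show ?thesis by (simp add: AE_iff_null_sets)
  qed
  ultimately show False by (simp add: negligible_iff_null_sets)
qed

lemma forall_in_imp_AE: "forall_in E P \<Longrightarrow> AE x in lebesgue. P x"
  by (cases E) auto

lemma forall_in_if_all: "(\<And>x. P x) \<Longrightarrow> forall_in E P"
  by (cases E) auto

lemma continuous_lebesgue_measurable:
  "continuous_on UNIV v \<Longrightarrow> v \<in> borel_measurable lebesgue" for v :: "'a::euclidean_space \<Rightarrow> real"
  by (rule measurable_completion) (simp add: borel_measurable_continuous_onI)

lemma space_of_continuous: "v \<in> space_of E \<Longrightarrow> E \<noteq> Linf \<Longrightarrow> continuous_on UNIV v"
  by (cases E) (auto intro: uniformly_continuous_imp_continuous)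

lemma space_of_measurable:
  assumes "v \<in> space_of E" shows "v \<in> borel_measurable lebesgue"
proof (cases "E = Linf")
  case False
  then show ?thesis
    using assms by (intro continuous_lebesgue_measurable space_of_continuous)
qed (use assms in simp)

text \<open>
  Together with \<open>forall_in_imp_AE\<close>, this makes the order of each of the three spaces the
  almost everywhere order.
\<close>

lemma le_in_if_AE:
  assumes "v \<in> space_of E" "w \<in> space_of E" "AE x in lebesgue. v x \<le> w x"
  shows "le_in E v w"
proof (cases "E = Linf")
  case False
  have "v x \<le> w x" for x
    using AE_le_imp_le_continuous assms space_of_continuous False by blast
  then show ?thesis by (simp add: le_in_def forall_in_if_all)
qed (use assms in \<open>simp add: le_in_def\<close>)

lemma bounded_range_real_iff: "bounded (range f) \<longleftrightarrow> (\<exists>C. \<forall>x. \<bar>f x\<bar> \<le> C)" for f :: "'a \<Rightarrow> real"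
  by (auto simp: bounded_iff)

lemma space_of_bounded:
  assumes "v \<in> space_of E" shows "\<exists>C. AE x in lebesgue. \<bar>v x\<bar> \<le> C"
proof (cases "E = Linf")
  case False
  then obtain C where "\<forall>x. \<bar>v x\<bar> \<le> C"
    using assms by (cases E) (auto simp: bounded_range_real_iff)
  then show ?thesis by auto
qed (use assms in auto)

lemma space_of_lincomb:
  assumes "v \<in> space_of E" "w \<in> space_of E"
  shows "(\<lambda>x. c * v x + d * w x) \<in> space_of E"
proof -
  have bd: "\<bar>c * s + d * t\<bar> \<le> \<bar>c\<bar> * C + \<bar>d\<bar> * D" if "\<bar>s\<bar> \<le> C" "\<bar>t\<bar> \<le> D" for s t C D :: real
  proof -
    have "\<bar>c * s + d * t\<bar> \<le> \<bar>c\<bar> * \<bar>s\<bar> + \<bar>d\<bar> * \<bar>t\<bar>"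
      by (metis abs_mult abs_triangle_ineq)
    also have "\<dots> \<le> \<bar>c\<bar> * C + \<bar>d\<bar> * D"
      using that by (intro add_mono mult_left_mono) auto
    finally show ?thesis .
  qed
  show ?thesis
  proof (cases E)
    case Linf
    obtain C D where "AE x in lebesgue. \<bar>v x\<bar> \<le> C" "AE x in lebesgue. \<bar>w x\<bar> \<le> D"
      using assms space_of_bounded by blast
    then have "AE x in lebesgue. \<bar>c * v x + d * w x\<bar> \<le> \<bar>c\<bar> * C + \<bar>d\<bar> * D"
      by eventually_elim (rule bd)
    then show ?thesis using assms Linf by auto
  next
    case Cub
    have "bounded (range (\<lambda>x. c * v x + d * w x))"
      using bd assms unfolding Cub bounded_range_real_iff space_of.simps mem_Collect_eq by meson
    moreover have "uniformly_continuous_on UNIV (\<lambda>x. c * v x + d * w x)"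
      using assms Cub by (auto intro!: uniformly_continuous_on_add uniformly_continuous_on_cmul_left)
    ultimately show ?thesis using Cub by simp
  next
    case Cb
    have "bounded (range (\<lambda>x. c * v x + d * w x))"
      using bd assms unfolding Cb bounded_range_real_iff space_of.simps mem_Collect_eq by meson
    moreover have "continuous_on UNIV (\<lambda>x. c * v x + d * w x)"
      using assms Cb by (auto intro!: continuous_intros)
    ultimately show ?thesis using Cb by simp
  qed
qed

lemma space_of_diff: "v \<in> space_of E \<Longrightarrow> w \<in> space_of E \<Longrightarrow> (\<lambda>x. v x - w x) \<in> space_of E"
  using space_of_lincomb[of v E w 1 "-1"] by simp

lemma AE_le_norm_in:
  assumes "f \<in> space_of E"
  shows "AE x in lebesgue. \<bar>f x\<bar> \<le> norm_in E f"
proof (cases "E = Linf")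
  case True
  have m: "(\<lambda>x. ereal \<bar>f x\<bar>) \<in> borel_measurable lebesgue"
    using space_of_measurable[OF assms] by measurable
  obtain C where C: "AE x in lebesgue. \<bar>f x\<bar> \<le> C" using space_of_bounded[OF assms] by blast
  let ?s = "esssup lebesgue (\<lambda>x. ereal \<bar>f x\<bar>)"
  have "?s \<le> ereal C" using m C by (intro esssup_I) auto
  moreover have "0 \<le> ?s"
  proof -
    have "esssup lebesgue (\<lambda>x::'a. 0::ereal) \<le> ?s" by (rule esssup_mono) auto
    then show ?thesis by (simp add: esssup_const)
  qed
  ultimately have "ereal (real_of_ereal ?s) = ?s"
    by (cases ?s) auto
  moreover have "AE x in lebesgue. ereal \<bar>f x\<bar> \<le> ?s" by (rule esssup_AE)
  ultimately have "AE x in lebesgue. ereal \<bar>f x\<bar> \<le> ereal (real_of_ereal ?s)" by simp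
  then show ?thesis using True by simp
next
  case False
  then have "bounded (range f)" using assms by (cases E) auto
  then have "bdd_above (range (\<lambda>x. \<bar>f x\<bar>))"
    unfolding bounded_range_real_iff by (auto intro: bdd_aboveI)
  then have "\<bar>f x\<bar> \<le> (SUP x. \<bar>f x\<bar>)" for x by (intro cSUP_upper) auto
  then show ?thesis using False by (cases E) auto
qed

lemma norm_in_le:
  assumes "f \<in> borel_measurable lebesgue" "\<And>x. \<bar>f x\<bar> \<le> C"
  shows "norm_in E f \<le> C"
proof (cases "E = Linf")
  case True
  let ?s = "esssup lebesgue (\<lambda>x. ereal \<bar>f x\<bar>)"
  have m: "(\<lambda>x. ereal \<bar>f x\<bar>) \<in> borel_measurable lebesgue"
    using assms(1) by measurable
  have "?s \<le> ereal C" using m assms(2) by (intro esssup_I) auto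
  moreover have "0 \<le> C" using assms(2)[of undefined] by linarith
  ultimately show ?thesis using True by (cases ?s) auto
next
  case False
  have "(SUP x. \<bar>f x\<bar>) \<le> C" using assms(2) by (intro cSUP_least) auto
  then show ?thesis using False by (cases E) auto
qed

lemma le_in_add_scaled:
  assumes "le_in E f g" "le_in E v w" "0 \<le> c"
  shows "le_in E (\<lambda>x. f x + c * v x) (\<lambda>x. g x + c * w x)"
proof -
  have *: "s + c * s' \<le> t + c * t'" if "s \<le> t" "s' \<le> t'" for s t s' t' :: real
    using that assms(3) by (intro add_mono mult_left_mono)
  show ?thesis
    using assms(1,2) unfolding le_in_def by (cases E) (auto elim!: eventually_elim2 intro: *)
qed

lemma EplusD:
  assumes "v \<in> Eplus E r"
  shows "v \<in> space_of E" "AE x in lebesgue. 0 \<le> v x \<and> v x \<le> r" "v \<in> borel_measurable lebesgue"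
proof -
  show "v \<in> space_of E" using assms by (simp add: Eplus_def)
  then show "v \<in> borel_measurable lebesgue" by (rule space_of_measurable)
  have "le_in E (\<lambda>_. 0) v" "le_in E v (\<lambda>_. r)" using assms by (auto simp: Eplus_def)
  then have "AE x in lebesgue. 0 \<le> v x" "AE x in lebesgue. v x \<le> r"
    unfolding le_in_def by (auto dest: forall_in_imp_AE)
  then show "AE x in lebesgue. 0 \<le> v x \<and> v x \<le> r" by eventually_elim simp
qed

lemma const_in_Eplus: "0 \<le> c \<Longrightarrow> c \<le> r \<Longrightarrow> (\<lambda>_. c) \<in> Eplus E r"
  by (cases E) (auto simp: Eplus_def le_in_def bounded_range_real_iff uniformly_continuous_on_const)

lemma scaled_in_Eplus:
  assumes "w \<in> Eplus E r" "0 \<le> z" "z \<le> 1"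
  shows "(\<lambda>x. z * w x) \<in> Eplus E r"
proof -
  have "(\<lambda>x. z * w x) \<in> space_of E"
    using space_of_lincomb[OF EplusD(1)[OF assms(1)] EplusD(1)[OF assms(1)], of z 0] by simp
  have sc: "0 \<le> z * s \<and> z * s \<le> r" if "0 \<le> s \<and> s \<le> r" for s
    using that assms mult_left_le_one_le[of s z] by auto
  have "forall_in E (\<lambda>x. 0 \<le> w x)" "forall_in E (\<lambda>x. w x \<le> r)"
    using assms(1) by (auto simp: Eplus_def le_in_def)
  then have "forall_in E (\<lambda>x. 0 \<le> z * w x) \<and> forall_in E (\<lambda>x. z * w x \<le> r)"
    using sc by (cases E) (auto elim!: eventually_elim2)
  then show ?thesis using \<open>_ \<in> space_of E\<close> by (simp add: Eplus_def le_in_def)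
qed

section \<open>The truncated paraboloid\<close>

text \<open>
  The barrier: the concave paraboloid of height 1 and radius \<open>L\<close>, cut off at zero. It is
  Lipschitz with compact support, so its multiples and translates belong to all three spaces.
\<close>

definition paraboloid :: "real \<Rightarrow> 'a::euclidean_space \<Rightarrow> real" where
  "paraboloid L x = max 0 (1 - (norm x)\<^sup>2 / L\<^sup>2)"

lemma paraboloid_nonneg: "0 \<le> paraboloid L x"
  and paraboloid_le_1: "paraboloid L x \<le> 1"
  and paraboloid_ge: "1 - (norm x)\<^sup>2 / L\<^sup>2 \<le> paraboloid L x"
  by (auto simp: paraboloid_def)

lemma paraboloid_eq_0: "0 < L \<Longrightarrow> L \<le> norm x \<Longrightarrow> paraboloid L x = 0"
  by (simp add: paraboloid_def field_simps power_mono)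

lemma paraboloid_eq: "0 < L \<Longrightarrow> norm x \<le> L \<Longrightarrow> paraboloid L x = 1 - (norm x)\<^sup>2 / L\<^sup>2"
  by (simp add: paraboloid_def field_simps power_mono)

lemma paraboloid_lipschitz:
  assumes "0 < L"
  shows "\<bar>paraboloid L x - paraboloid L y\<bar> \<le> 2 / L * norm (x - y)"
proof -
  define r s where "r = min 1 (norm x / L)" and "s = min 1 (norm y / L)"
  have sq: "paraboloid L z = 1 - (min 1 (norm z / L))\<^sup>2" for z :: 'a
  proof (cases "norm z \<le> L")
    case True
    then have "min 1 (norm z / L) = norm z / L" using assms by (simp add: min_def)
    then show ?thesis using True assms by (simp add: paraboloid_eq power_divide)
  next
    case False
    then have "min 1 (norm z / L) = 1" using assms by (simp add: min_def)
    then show ?thesis using False assms by (simp add: paraboloid_eq_0)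
  qed
  have rs: "0 \<le> r" "r \<le> 1" "0 \<le> s" "s \<le> 1"
    using assms by (auto simp: r_def s_def)
  have "\<bar>r - s\<bar> \<le> \<bar>norm x / L - norm y / L\<bar>" by (auto simp: r_def s_def min_def)
  also have "\<dots> = \<bar>norm x - norm y\<bar> / L" using assms by (simp add: diff_divide_distrib[symmetric])
  also have "\<dots> \<le> norm (x - y) / L"
    using assms norm_triangle_ineq3[of x y] by (simp add: divide_right_mono)
  finally have d: "\<bar>r - s\<bar> \<le> norm (x - y) / L" .
  have "paraboloid L x - paraboloid L y = (s + r) * (s - r)"
    unfolding sq r_def[symmetric] s_def[symmetric] by (simp add: power2_eq_square algebra_simps)
  then have "\<bar>paraboloid L x - paraboloid L y\<bar> = (s + r) * \<bar>r - s\<bar>"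
    using rs by (simp add: abs_mult abs_minus_commute)
  also have "\<dots> \<le> 2 * (norm (x - y) / L)"
    using rs d by (intro mult_mono) auto
  finally show ?thesis by simp
qed

lemma paraboloid_lebesgue_measurable:
  "paraboloid L \<in> borel_measurable (lebesgue :: 'a::euclidean_space measure)"
  unfolding paraboloid_def by (rule measurable_completion) measurable

lemma paraboloid_ge_on_half_ball:
  assumes "0 < L" "norm x \<le> L / 2"
  shows "3 / 4 \<le> paraboloid L x"
proof -
  have "(norm x)\<^sup>2 \<le> (L / 2)\<^sup>2" using assms by (intro power_mono) auto
  then have "(norm x)\<^sup>2 / L\<^sup>2 \<le> 1 / 4" using assms by (simp add: divide_le_eq power2_eq_square)
  then show ?thesis using paraboloid_ge[of x L] by linarith
qed

lemma paraboloid_tendsto_1: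
  assumes "\<epsilon> > 0"
  shows "\<forall>\<^sub>F n in sequentially. \<forall>x::'a::euclidean_space. norm x \<le> R \<longrightarrow> 1 - \<epsilon> < paraboloid (real (Suc n)) x"
proof -
  define R' where "R' = max R 0"
  have "(\<lambda>n. R'\<^sup>2 * (1 / real (Suc n))\<^sup>2) \<longlonglongrightarrow> R'\<^sup>2 * 0\<^sup>2"
    by (intro tendsto_intros LIMSEQ_Suc[OF lim_1_over_n])
  then have "\<forall>\<^sub>F n in sequentially. R'\<^sup>2 * (1 / real (Suc n))\<^sup>2 < \<epsilon>"
    using assms by (intro order_tendstoD(2)) auto
  then show ?thesis
  proof eventually_elim
    case (elim n)
    show ?case
    proof (intro allI impI)
      fix x :: 'a assume "norm x \<le> R"
      then have "(norm x)\<^sup>2 \<le> R'\<^sup>2" by (intro power_mono) (auto simp: R'_def)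
      then have "(norm x)\<^sup>2 / (real (Suc n))\<^sup>2 \<le> R'\<^sup>2 / (real (Suc n))\<^sup>2" by (rule divide_right_mono) simp
      also have "\<dots> < \<epsilon>" using elim by (simp add: power_divide)
      finally show "1 - \<epsilon> < paraboloid (real (Suc n)) x" using paraboloid_ge[of x "real (Suc n)"] by linarith
    qed
  qed
qed

lemma scaled_paraboloid_in_Eplus:
  fixes y :: "'a::euclidean_space"
  assumes "0 < L" "0 \<le> c" "c \<le> r"
  shows "(\<lambda>x. c * paraboloid L (x - y)) \<in> Eplus E r"
proof -
  have le: "0 \<le> c * paraboloid L (x - y)" "c * paraboloid L (x - y) \<le> r" for x
    using assms paraboloid_nonneg[of L "x - y"] paraboloid_le_1[of L "x - y"] mult_left_le[of "paraboloid L (x - y)" c]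
    by auto
  have b: "bounded (range (\<lambda>x. c * paraboloid L (x - y)))"
    unfolding bounded_range_real_iff using le by (intro exI[of _ r]) auto
  have "(2 * c / L)-lipschitz_on UNIV (\<lambda>x. c * paraboloid L (x - y))"
  proof (rule lipschitz_onI)
    fix x x' :: 'a
    have "dist (c * paraboloid L (x - y)) (c * paraboloid L (x' - y))
        = c * \<bar>paraboloid L (x - y) - paraboloid L (x' - y)\<bar>"
      using assms(2) by (simp add: dist_real_def abs_mult right_diff_distrib[symmetric])
    also have "\<dots> \<le> c * (2 / L * norm ((x - y) - (x' - y)))"
      using assms by (intro mult_left_mono paraboloid_lipschitz)
    finally show "dist (c * paraboloid L (x - y)) (c * paraboloid L (x' - y)) \<le> 2 * c / L * dist x x'"
      by (simp add: dist_norm algebra_simps)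
  qed (use assms in simp)
  then have u: "uniformly_continuous_on UNIV (\<lambda>x. c * paraboloid L (x - y))"
    by (rule lipschitz_on_uniformly_continuous)
  have c: "continuous_on UNIV (\<lambda>x. c * paraboloid L (x - y))"
    by (rule uniformly_continuous_imp_continuous[OF u])
  have "(\<lambda>x. c * paraboloid L (x - y)) \<in> space_of E"
  proof (cases E)
    case Linf
    have "\<bar>c * paraboloid L (x - y)\<bar> \<le> r" for x using le[of x] by simp
    then show ?thesis using continuous_lebesgue_measurable[OF c] Linf by auto
  qed (use u b c in auto)
  then show ?thesis
    by (simp add: Eplus_def le_in_def forall_in_if_all le)
qed

text \<open>
  Comparison with the tangent plane at \<open>x\<close>. The quadratic error is small for bounded \<open>z\<close>; the
  linear one, from the Lipschitz bound, makes the error integrable against a kernel with a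
  finite first moment.
\<close>

lemma paraboloid_ge_tangent:
  fixes x z :: "'a::euclidean_space"
  assumes L: "0 < L" and x: "norm x \<le> L"
  shows "1 - (norm x)\<^sup>2 / L\<^sup>2 - 2 * (x \<bullet> z) / L\<^sup>2 - min ((norm z)\<^sup>2 / L) (4 * norm z) / L
    \<le> paraboloid L (x + z)"
proof -
  define q where "q = 1 - (norm x)\<^sup>2 / L\<^sup>2"
  have "(norm (x + z))\<^sup>2 = (norm x)\<^sup>2 + 2 * (x \<bullet> z) + (norm z)\<^sup>2"
    by (simp add: power2_norm_eq_inner inner_simps inner_commute)
  then have "q - 2 * (x \<bullet> z) / L\<^sup>2 - (norm z)\<^sup>2 / L\<^sup>2 = 1 - (norm (x + z))\<^sup>2 / L\<^sup>2"
    by (simp add: q_def add_divide_distrib)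
  also have "\<dots> \<le> paraboloid L (x + z)" by (rule paraboloid_ge)
  finally have 1: "q - 2 * (x \<bullet> z) / L\<^sup>2 - (norm z)\<^sup>2 / L / L \<le> paraboloid L (x + z)"
    by (simp add: power2_eq_square)
  have "\<bar>paraboloid L (x + z) - paraboloid L x\<bar> \<le> 2 / L * norm z"
    using paraboloid_lipschitz[OF L, of "x + z" x] by simp
  then have "q - 2 / L * norm z \<le> paraboloid L (x + z)"
    using paraboloid_eq[OF L x] by (simp add: q_def)
  moreover have "- 2 * (x \<bullet> z) / L\<^sup>2 \<le> 2 / L * norm z"
  proof -
    have "- (x \<bullet> z) \<le> norm x * norm z" using Cauchy_Schwarz_ineq2[of x z] by linarith
    also have "\<dots> \<le> L * norm z" using x by (intro mult_right_mono) auto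
    finally have "- 2 * (x \<bullet> z) / L\<^sup>2 \<le> 2 * (L * norm z) / L\<^sup>2" by (intro divide_right_mono) auto
    also have "\<dots> = 2 / L * norm z" using L by (simp add: power2_eq_square)
    finally show ?thesis .
  qed
  ultimately have 2: "q - 2 * (x \<bullet> z) / L\<^sup>2 - 4 * norm z / L \<le> paraboloid L (x + z)" by simp
  show ?thesis using 1 2 unfolding q_def[symmetric] by (simp add: min_def)
qed

text \<open>
  If \<open>x\<close> is close to the edge of the paraboloid and \<open>- y\<close> points outwards, then
  the tangent plane at \<open>x\<close>, evaluated at \<open>x + d - y\<close>, is negative of order \<open>1 / L\<close>.
  As the paraboloid itself is nonnegative, it lies above the plane by that amount.
\<close>

lemma paraboloid_tangent_negative:
  fixes x y d :: "'a::euclidean_space"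
  assumes \<rho>: "0 < \<rho>" "\<rho> \<le> L" and x: "norm x \<le> L" "1 - (norm x)\<^sup>2 / L\<^sup>2 \<le> \<rho> / (8 * L)"
    and y: "norm (y + (3 * \<rho> / (4 * norm x)) *\<^sub>R x) \<le> \<rho> / 4" and d: "norm d \<le> \<rho> / 8"
  shows "1 - (norm x)\<^sup>2 / L\<^sup>2 - 2 * (x \<bullet> (d - y)) / L\<^sup>2 \<le> - (\<rho> / (4 * L))"
proof -
  have L: "0 < L" using \<rho> by simp
  have "\<rho> / (8 * L) \<le> 1 / 8" using \<rho> L by (simp add: field_simps)
  then have "3 / 4 \<le> (norm x)\<^sup>2 / L\<^sup>2" using x by linarith
  then have "3 / 4 * L\<^sup>2 \<le> (norm x)\<^sup>2" using L by (simp add: pos_le_divide_eq)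
  then have "(L / 2)\<^sup>2 \<le> (norm x)\<^sup>2"
  proof -
    have "(L / 2)\<^sup>2 = L\<^sup>2 / 4" by (simp add: power_divide)
    moreover have "0 \<le> L\<^sup>2" by simp
    ultimately show ?thesis using \<open>3 / 4 * L\<^sup>2 \<le> (norm x)\<^sup>2\<close> by linarith
  qed
  then have nx: "L / 2 \<le> norm x" by (rule power2_le_imp_le) simp
  then have x0: "0 < norm x" using L by linarith
  define c where "c = (3 * \<rho> / (4 * norm x)) *\<^sub>R x"
  have xc: "x \<bullet> c = 3 * \<rho> / 4 * norm x"
    using x0 by (simp add: c_def power2_norm_eq_inner[symmetric] power2_eq_square)
  have "x \<bullet> (y + c) \<le> norm x * (\<rho> / 4)"
    using Cauchy_Schwarz_ineq2[of x "y + c"] y mult_left_mono[of "norm (y + c)" "\<rho> / 4" "norm x"]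
    unfolding c_def[symmetric] by simp
  then have xy: "x \<bullet> y \<le> - (\<rho> / 2) * norm x" using xc by (simp add: inner_simps algebra_simps)
  have "- (x \<bullet> d) \<le> norm x * (\<rho> / 8)"
    using Cauchy_Schwarz_ineq2[of x d] d mult_left_mono[of "norm d" "\<rho> / 8" "norm x"] by simp
  then have "3 / 8 * \<rho> * norm x \<le> x \<bullet> (d - y)" using xy by (simp add: inner_simps algebra_simps)
  moreover have "3 / 8 * \<rho> * (L / 2) \<le> 3 / 8 * \<rho> * norm x" using nx \<rho> by (intro mult_left_mono) auto
  ultimately have "3 / 8 * \<rho> * L \<le> 2 * (x \<bullet> (d - y))" by linarith
  then have "3 / 8 * \<rho> * L / L\<^sup>2 \<le> 2 * (x \<bullet> (d - y)) / L\<^sup>2" by (intro divide_right_mono) auto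
  then have "3 / 8 * \<rho> / L \<le> 2 * (x \<bullet> (d - y)) / L\<^sup>2" using L by (simp add: power2_eq_square)
  then show "1 - (norm x)\<^sup>2 / L\<^sup>2 - 2 * (x \<bullet> (d - y)) / L\<^sup>2 \<le> - (\<rho> / (4 * L))"
    using x(2) by (simp add: field_simps)
qed

section \<open>Lower bounds for solutions by one explicit time step\<close>

text \<open>
  Gronwall's lemma for \<open>\<phi>' \<ge> k - M \<phi>\<close>, with the exponentials replaced by the lower bounds
  \<open>1 - M h \<le> exp (- M h)\<close> and \<open>h (1 - M h) \<le> (1 - exp (- M h)) / M\<close>; all later estimates thereby become
  polynomial in \<open>h\<close>.
\<close>

lemma differential_inequality:
  fixes \<phi> :: "real \<Rightarrow> real"
  assumes "0 \<le> h" "0 < M" "M * h \<le> 1" "0 \<le> k" "0 \<le> \<phi> 0"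
    and cont: "continuous_on {0..h} \<phi>"
    and deriv: "\<And>s. 0 < s \<Longrightarrow> s < h \<Longrightarrow> \<exists>D. DERIV \<phi> s :> D \<and> k - M * \<phi> s \<le> D"
  shows "(1 - M * h) * \<phi> 0 + h * (1 - M * h) * k \<le> \<phi> h"
proof -
  define \<psi> where "\<psi> s = exp (M * s) * \<phi> s - k / M * exp (M * s)" for s
  have "\<psi> 0 \<le> \<psi> h"
  proof (rule DERIV_nonneg_imp_increasing_open[OF \<open>0 \<le> h\<close>])
    show "continuous_on {0..h} \<psi>" unfolding \<psi>_def by (intro continuous_intros cont)
    fix s assume "0 < s" "s < h"
    then obtain D where D: "DERIV \<phi> s :> D" "k - M * \<phi> s \<le> D" using deriv by blast
    have "DERIV \<psi> s :> exp (M * s) * (D - (k - M * \<phi> s))"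
      unfolding \<psi>_def using \<open>0 < M\<close>
      by (auto intro!: derivative_eq_intros D(1) simp: algebra_simps)
    then show "\<exists>y. DERIV \<psi> s :> y \<and> 0 \<le> y" using D(2) by fastforce
  qed
  then have "\<phi> 0 - k / M \<le> exp (M * h) * (\<phi> h - k / M)"
    by (simp add: \<psi>_def algebra_simps)
  then have "exp (- (M * h)) * (\<phi> 0 - k / M) \<le> exp (- (M * h)) * (exp (M * h) * (\<phi> h - k / M))"
    by (intro mult_left_mono) auto
  also have "\<dots> = \<phi> h - k / M"
    by (simp add: mult.assoc[symmetric] exp_add[symmetric])
  finally have *: "exp (- (M * h)) * \<phi> 0 + k * ((1 - exp (- (M * h))) / M) \<le> \<phi> h"
    by (simp add: algebra_simps diff_divide_distrib)
  define y where "y = M * h"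
  have y: "0 \<le> y" "y \<le> 1" using assms by (auto simp: y_def)
  have e1: "1 - y \<le> exp (- y)" using exp_ge_add_one_self[of "- y"] by simp
  have "exp (- y) \<le> 1 / (1 + y)"
    using exp_ge_add_one_self[of y] y by (simp add: exp_minus inverse_eq_divide frac_le)
  also have "\<dots> \<le> 1 - y + y\<^sup>2"
  proof -
    have "(1 - y + y\<^sup>2) * (1 + y) = 1 + y ^ 3" by (simp add: power2_eq_square power3_eq_cube algebra_simps)
    then have "1 \<le> (1 - y + y\<^sup>2) * (1 + y)" using y by simp
    then show ?thesis using y by (simp add: pos_divide_le_eq)
  qed
  finally have "y * (1 - y) \<le> 1 - exp (- y)" by (simp add: power2_eq_square algebra_simps)
  then have "h * (1 - y) \<le> (1 - exp (- y)) / M"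
    using \<open>0 < M\<close> by (simp add: y_def pos_le_divide_eq mult_ac)
  then have "k * (h * (1 - y)) \<le> k * ((1 - exp (- y)) / M)"
    using \<open>0 \<le> k\<close> by (rule mult_left_mono)
  moreover have "(1 - y) * \<phi> 0 \<le> exp (- y) * \<phi> 0"
    using e1 \<open>0 \<le> \<phi> 0\<close> by (rule mult_right_mono)
  ultimately show ?thesis using * unfolding y_def by (simp add: mult_ac)
qed

lemma integrable_indicator_mult:
  fixes f :: "'a::euclidean_space \<Rightarrow> real"
  assumes A: "A \<in> lmeasurable" and f: "f \<in> borel_measurable lebesgue" "AE x in lebesgue. \<bar>f x\<bar> \<le> C"
  shows "integrable lebesgue (\<lambda>x. indicator A x * f x)"
    and "\<bar>\<integral>x. indicator A x * f x \<partial>lebesgue\<bar> \<le> measure lebesgue A * C"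
proof -
  note [measurable] = fmeasurableD[OF A] f(1)
  have i: "integrable lebesgue (\<lambda>x. C * indicator A x)"
    using fmeasurableD2[OF A] fmeasurableD[OF A]
    by (intro integrable_mult_right integrable_real_indicator) (simp_all add: less_top)
  have b: "AE x in lebesgue. \<bar>indicator A x * f x\<bar> \<le> C * indicator A x"
    using f(2) by eventually_elim (auto simp: indicator_def)
  show I: "integrable lebesgue (\<lambda>x. indicator A x * f x)"
  proof (rule Bochner_Integration.integrable_bound[OF i])
    show "AE x in lebesgue. norm (indicator A x * f x) \<le> norm (C * indicator A x)"
      using f(2) by eventually_elim (auto simp: indicator_def)
  qed measurable
  have "\<bar>\<integral>x. indicator A x * f x \<partial>lebesgue\<bar> \<le> (\<integral>x. \<bar>indicator A x * f x\<bar> \<partial>lebesgue)"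
    by (rule integral_abs_bound)
  also have "\<dots> \<le> (\<integral>x. C * indicator A x \<partial>lebesgue)"
    using I i b by (intro integral_mono_AE) auto
  also have "\<dots> = measure lebesgue A * C" by simp
  finally show "\<bar>\<integral>x. indicator A x * f x \<partial>lebesgue\<bar> \<le> measure lebesgue A * C" .
qed

text \<open>
  The equation with its quasi-monotonicity, and a classical solution \<open>u\<close> with values in \<open>[0, \<theta>]\<close>.
\<close>

locale nonlocal_equation =
  fixes E :: space_kind
    and a u0 :: "'a::euclidean_space \<Rightarrow> real"
    and G :: "('a \<Rightarrow> real) \<Rightarrow> ('a \<Rightarrow> real)"
    and u :: "real \<Rightarrow> 'a \<Rightarrow> real"
    and m \<kappa> \<theta> p :: real
  assumes m_pos: "0 < m" and kappa_pos: "0 < \<kappa>" and theta_pos: "0 < \<theta>" and p_nonneg: "0 \<le> p"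
    and a_nonneg: "AE x in lebesgue. 0 \<le> a x"
    and a_int: "integrable lebesgue a"
    and a_mass: "(\<integral>x. a x \<partial>lebesgue) = 1"
    and quasi_monotone: "\<And>v w. v \<in> Eplus E \<theta> \<Longrightarrow> w \<in> Eplus E \<theta> \<Longrightarrow> le_in E v w \<Longrightarrow>
      le_in E (\<lambda>x. \<kappa> * conv a v x - v x * G v x + p * v x)
              (\<lambda>x. \<kappa> * conv a w x - w x * G w x + p * w x)"
    and sol: "classical_solution E \<kappa> m a G u0 u"
    and sol_range: "\<And>t. t \<ge> 0 \<Longrightarrow> u t \<in> Eplus E \<theta>"
begin

text \<open>
  With \<open>M\<close> and \<open>F\<close> the equation reads \<open>u' = F u - M u\<close>, where \<open>F\<close> is monotone and \<open>F 0 = 0\<close>.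
\<close>

definition M :: real where "M = m + p"

definition F :: "('a \<Rightarrow> real) \<Rightarrow> 'a \<Rightarrow> real" where
  "F v x = \<kappa> * conv a v x - v x * G v x + p * v x"

lemma M_pos: "0 < M"
  using m_pos p_nonneg by (simp add: M_def)

lemma a_measurable [measurable]: "a \<in> borel_measurable lebesgue"
  using a_int by measurable

lemma F_mono:
  assumes "v \<in> Eplus E \<theta>" "w \<in> Eplus E \<theta>" "AE x in lebesgue. v x \<le> w x"
  shows "AE x in lebesgue. F v x \<le> F w x"
proof -
  have "le_in E v w" using assms by (intro le_in_if_AE EplusD(1))
  then have "le_in E (F v) (F w)"
    using quasi_monotone[of v w] assms unfolding F_def by blast
  then show ?thesis unfolding le_in_def by (rule forall_in_imp_AE)
qed

lemma F_nonneg: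
  assumes "v \<in> Eplus E \<theta>"
  shows "AE x in lebesgue. 0 \<le> F v x"
proof -
  have "AE x in lebesgue. F (\<lambda>_. 0) x \<le> F v x"
  proof (rule F_mono)
    show "AE x in lebesgue. 0 \<le> v x" using EplusD(2)[OF assms] by eventually_elim simp
    show "(\<lambda>_. 0) \<in> Eplus E \<theta>" using theta_pos by (intro const_in_Eplus) auto
  qed (fact assms)
  then show ?thesis by (simp add: F_def conv_def)
qed

lemma sol_AE_bounds: "0 \<le> t \<Longrightarrow> AE x in lebesgue. 0 \<le> u t x \<and> u t x \<le> \<theta>"
  using EplusD(2)[OF sol_range] by blast

lemma sol_abs_bound: "0 \<le> t \<Longrightarrow> AE x in lebesgue. \<bar>u t x\<bar> \<le> \<theta>"
  using eventually_mono[OF sol_AE_bounds] by (metis (no_types, lifting) abs_of_nonneg)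

lemma sol_integral_continuous:
  assumes A: "A \<in> lmeasurable"
  shows "continuous_on {0..} (\<lambda>t. \<integral>x. indicator A x * u t x \<partial>lebesgue)" (is "continuous_on _ ?I")
  unfolding continuous_on_def
proof
  fix t :: real assume t: "t \<in> {0..}"
  have "((\<lambda>s. norm_in E (\<lambda>x. u s x - u t x)) \<longlongrightarrow> 0) (at t within {0..})"
    using sol t by (auto simp: classical_solution_def continuous_into_def)
  then have lim: "((\<lambda>s. measure lebesgue A * norm_in E (\<lambda>x. u s x - u t x)) \<longlongrightarrow> 0) (at t within {0..})"
    by (rule tendsto_mult_right_zero)
  have "\<forall>\<^sub>F s in at t within {0..}. s \<in> {0..}"
    by (simp add: eventually_at_filter)
  then have "\<forall>\<^sub>F s in at t within {0..}. norm (?I s - ?I t) \<le> measure lebesgue A * norm_in E (\<lambda>x. u s x - u t x)"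
  proof eventually_elim
    case (elim s)
    have sp: "(\<lambda>x. u s x - u t x) \<in> space_of E"
      using elim t EplusD(1)[OF sol_range] by (intro space_of_diff) auto
    have i: "integrable lebesgue (\<lambda>x. indicator A x * u r x)" if "0 \<le> r" for r
      using integrable_indicator_mult(1)[OF A EplusD(3)[OF sol_range[OF that]] sol_abs_bound[OF that]] .
    have "?I s - ?I t = (\<integral>x. indicator A x * u s x - indicator A x * u t x \<partial>lebesgue)"
      using elim t by (intro Bochner_Integration.integral_diff[symmetric] i) auto
    also have "\<dots> = (\<integral>x. indicator A x * (u s x - u t x) \<partial>lebesgue)"
      by (simp add: right_diff_distrib)
    finally show ?case
      using integrable_indicator_mult(2)[OF A space_of_measurable[OF sp] AE_le_norm_in[OF sp]] by simp
  qed
  then have "((\<lambda>s. ?I s - ?I t) \<longlongrightarrow> 0) (at t within {0..})"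
    using lim by (rule Lim_null_comparison)
  then show "(?I \<longlongrightarrow> ?I t) (at t within {0..})" by (rule LIM_zero_cancel)
qed

lemma sol_integral_deriv:
  assumes A: "A \<in> lmeasurable" and t: "0 < t"
    and f: "f \<in> borel_measurable lebesgue" "AE x in lebesgue. \<bar>f x\<bar> \<le> C"
    and le: "AE x in lebesgue. f x \<le> F (u t) x"
  shows "\<exists>D. DERIV (\<lambda>t. \<integral>x. indicator A x * u t x \<partial>lebesgue) t :> D \<and>
    (\<integral>x. indicator A x * f x \<partial>lebesgue) - M * (\<integral>x. indicator A x * u t x \<partial>lebesgue) \<le> D"
proof -
  let ?I = "\<lambda>t. \<integral>x. indicator A x * u t x \<partial>lebesgue"
  obtain u' where "continuous_into E {0<..} u'" "\<forall>t>0. has_derivative_into E u (u' t) t"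
    "\<forall>t>0. eq_in E (u' t) (\<lambda>x. \<kappa> * conv a (u t) x - m * u t x - u t x * G (u t) x)"
    using sol unfolding classical_solution_def by blast
  then have u': "u' t \<in> space_of E" "has_derivative_into E u (u' t) t"
    "eq_in E (u' t) (\<lambda>x. \<kappa> * conv a (u t) x - m * u t x - u t x * G (u t) x)"
    using t unfolding continuous_into_def by simp_all
  obtain C' where C': "AE x in lebesgue. \<bar>u' t x\<bar> \<le> C'" using space_of_bounded[OF u'(1)] by blast
  note iu' = integrable_indicator_mult(1)[OF A space_of_measurable[OF u'(1)] C']
  have i: "integrable lebesgue (\<lambda>x. indicator A x * u r x)" if "0 \<le> r" for r
    using integrable_indicator_mult(1)[OF A EplusD(3)[OF sol_range[OF that]] sol_abs_bound[OF that]] .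
  let ?D = "\<integral>x. indicator A x * u' t x \<partial>lebesgue"
  have "DERIV ?I t :> ?D"
    unfolding DERIV_def
  proof (rule LIM_zero_cancel, rule Lim_null_comparison)
    show "((\<lambda>h. measure lebesgue A * norm_in E (\<lambda>x. (u (t + h) x - u t x) / h - u' t x)) \<longlongrightarrow> 0) (at 0)"
      using u'(2) unfolding has_derivative_into_def by (rule tendsto_mult_right_zero)
    have "\<forall>\<^sub>F h in at 0. - t < h" using order_tendstoD(1)[OF tendsto_ident_at, of "- t" 0] t by simp
    moreover have "\<forall>\<^sub>F h::real in at 0. h \<noteq> 0" by (simp add: eventually_at_filter)
    ultimately show "\<forall>\<^sub>F h in at 0. norm ((?I (t + h) - ?I t) / h - ?D)
      \<le> measure lebesgue A * norm_in E (\<lambda>x. (u (t + h) x - u t x) / h - u' t x)"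
    proof eventually_elim
      case (elim h)
      have h: "0 \<le> t + h" using elim by simp
      have "(\<lambda>x. 1 / h * u (t + h) x + (- 1 / h) * u t x) \<in> space_of E"
        using h t EplusD(1)[OF sol_range] by (intro space_of_lincomb) auto
      then have "(\<lambda>x. (u (t + h) x - u t x) / h) \<in> space_of E" by (simp add: diff_divide_distrib)
      then have sp: "(\<lambda>x. (u (t + h) x - u t x) / h - u' t x) \<in> space_of E"
        using u'(1) by (rule space_of_diff)
      have "(?I (t + h) - ?I t) / h - ?D =
        (\<integral>x. (indicator A x * u (t + h) x - indicator A x * u t x) / h - indicator A x * u' t x \<partial>lebesgue)"
        using i[OF h] i[of t] t iu' by simp
      also have "\<dots> = (\<integral>x. indicator A x * ((u (t + h) x - u t x) / h - u' t x) \<partial>lebesgue)"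
        by (intro Bochner_Integration.integral_cong) (auto simp: algebra_simps diff_divide_distrib)
      finally show ?case
        using integrable_indicator_mult(2)[OF A space_of_measurable[OF sp] AE_le_norm_in[OF sp]] by simp
    qed
  qed
  moreover have "(\<integral>x. indicator A x * f x \<partial>lebesgue) - M * ?I t \<le> ?D"
  proof -
    have iff: "integrable lebesgue (\<lambda>x. indicator A x * f x)"
      using integrable_indicator_mult(1)[OF A f] .
    have "AE x in lebesgue. u' t x = F (u t) x - M * u t x"
      using forall_in_imp_AE[OF u'(3)[unfolded eq_in_def]]
      by eventually_elim (simp add: F_def M_def algebra_simps)
    with le have "AE x in lebesgue. indicator A x * f x - M * (indicator A x * u t x) \<le> indicator A x * u' t x"
      by eventually_elim (auto simp: indicator_def)
    then have "(\<integral>x. indicator A x * f x - M * (indicator A x * u t x) \<partial>lebesgue) \<le> ?D"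
      using iff i[of t] t iu' by (intro integral_mono_AE) auto
    then show ?thesis using iff i[of t] t by simp
  qed
  ultimately show ?thesis by blast
qed

lemma sol_integral_step:
  assumes A: "A \<in> lmeasurable" and t: "0 \<le> t" and h: "0 \<le> h" "M * h \<le> 1"
    and f: "f \<in> borel_measurable lebesgue" "AE x in lebesgue. \<bar>f x\<bar> \<le> C" "\<And>x. 0 \<le> f x"
    and le: "\<And>s. 0 < s \<Longrightarrow> s < h \<Longrightarrow> AE x in lebesgue. f x \<le> F (u (t + s)) x"
  shows "(\<integral>x. indicator A x * ((1 - M * h) * u t x + h * (1 - M * h) * f x) \<partial>lebesgue)
    \<le> (\<integral>x. indicator A x * u (t + h) x \<partial>lebesgue)"
proof -
  let ?I = "\<lambda>s. \<integral>x. indicator A x * u (t + s) x \<partial>lebesgue"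
  let ?k = "\<integral>x. indicator A x * f x \<partial>lebesgue"
  have "(1 - M * h) * ?I 0 + h * (1 - M * h) * ?k \<le> ?I h"
  proof (rule differential_inequality[OF h(1) M_pos h(2)])
    show "0 \<le> ?k" using f(3) by simp
    have "AE x in lebesgue. 0 \<le> indicator A x * u t x"
      using sol_AE_bounds[OF t] by eventually_elim simp
    then show "0 \<le> ?I 0" by (simp add: integral_nonneg_AE)
    show "continuous_on {0..h} ?I"
      using t by (intro continuous_on_compose2[OF sol_integral_continuous[OF A], of _ "\<lambda>s. t + s"] continuous_intros) auto
    fix s assume s: "0 < s" "s < h"
    then have "0 < t + s" using t by simp
    from sol_integral_deriv[OF A this f(1,2) le[OF s]] obtain D where
      D: "DERIV (\<lambda>t. \<integral>x. indicator A x * u t x \<partial>lebesgue) (t + s) :> D" "?k - M * ?I s \<le> D"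
      by blast
    have "DERIV ?I s :> D"
      using DERIV_shift[of "\<lambda>t. \<integral>x. indicator A x * u t x \<partial>lebesgue" D s t] D(1) by (simp add: add.commute)
    with D(2) show "\<exists>D. DERIV ?I s :> D \<and> ?k - M * ?I s \<le> D" by blast
  qed
  moreover have "(\<integral>x. indicator A x * ((1 - M * h) * u t x + h * (1 - M * h) * f x) \<partial>lebesgue)
    = (\<integral>x. (1 - M * h) * (indicator A x * u t x) + h * (1 - M * h) * (indicator A x * f x) \<partial>lebesgue)"
    by (intro Bochner_Integration.integral_cong) (auto simp: algebra_simps)
  moreover have "\<dots> = (1 - M * h) * ?I 0 + h * (1 - M * h) * ?k"
    using integrable_indicator_mult(1)[OF A EplusD(3)[OF sol_range[OF t]] sol_abs_bound[OF t]]
      integrable_indicator_mult(1)[OF A f(1,2)] by simp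
  ultimately show ?thesis by simp
qed

lemma sol_decay:
  assumes t: "0 \<le> t" and h: "0 \<le> h" "M * h \<le> 1"
  shows "AE x in lebesgue. (1 - M * h) * u t x \<le> u (t + h) x"
proof -
  have th: "0 \<le> t + h" using t h by simp
  note [measurable] = EplusD(3)[OF sol_range[OF t]] EplusD(3)[OF sol_range[OF th]]
  have Mh: "0 \<le> M * h" using M_pos h by simp
  show ?thesis
  proof (rule AE_le_if_integral_le[where C = \<theta>])
    show "AE x in lebesgue. \<bar>(1 - M * h) * u t x\<bar> \<le> \<theta>"
      using sol_AE_bounds[OF t]
    proof eventually_elim
      case (elim x)
      then show ?case using h Mh mult_left_le_one_le[of "u t x" "1 - M * h"] by (simp add: abs_mult)
    qed
    show "AE x in lebesgue. \<bar>u (t + h) x\<bar> \<le> \<theta>" by (rule sol_abs_bound[OF th])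
    fix A :: "'a set" assume A: "A \<in> lmeasurable"
    have "AE x in lebesgue. 0 \<le> F (u (t + s)) x" if "0 < s" for s
      using that t by (intro F_nonneg sol_range) simp
    then show "(\<integral>x. indicator A x * ((1 - M * h) * u t x) \<partial>lebesgue) \<le> (\<integral>x. indicator A x * u (t + h) x \<partial>lebesgue)"
      using sol_integral_step[OF A t h, of "\<lambda>_. 0" 0] by simp
  qed measurable
qed

text \<open>
  The one-step bound: \<open>w \<le> u t\<close> implies \<open>z w + h z F (z w) \<le> u (t + h)\<close> with
  \<open>z = 1 - M h\<close>. During the step the solution stays above \<open>z w\<close> by \<open>sol_decay\<close>, hence \<open>F u \<ge> F (z w)\<close> by monotonicity, and this is integrated in time. The bound is stated
  with a measurable bounded minorant \<open>v\<close> of the left-hand side, so that neither measurability nor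
  boundedness of \<open>F (z w)\<close> is needed.
\<close>

lemma sol_step:
  assumes t: "0 \<le> t" and h: "0 < h" "M * h < 1"
    and w: "w \<in> Eplus E \<theta>" "AE x in lebesgue. w x \<le> u t x"
    and v: "v \<in> borel_measurable lebesgue" "\<And>x. \<bar>v x\<bar> \<le> C"
    and le: "AE x in lebesgue. v x \<le> (1 - M * h) * w x + h * (1 - M * h) * F (\<lambda>x. (1 - M * h) * w x) x"
  shows "AE x in lebesgue. v x \<le> u (t + h) x"
proof -
  define z where "z = 1 - M * h"
  have z: "0 < z" "z \<le> 1" using h M_pos by (auto simp: z_def)
  \<comment> \<open>A nonnegative bounded minorant of \<open>F (z w)\<close> that is large enough for \<open>v \<le> z w + h z f\<close>. The cap
    by \<open>C + 1\<close> only ensures boundedness, because \<open>v - z w \<le> C\<close> almost everywhere.\<close>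
  define f where "f x = max 0 (min ((v x - z * w x) / (h * z)) ((C + 1) / (h * z)))" for x
  have th: "0 \<le> t + h" using t h by simp
  note [measurable] = EplusD(3)[OF sol_range[OF t]] EplusD(3)[OF sol_range[OF th]] v(1) EplusD(3)[OF w(1)]
  have C: "0 \<le> C" using v(2)[of 0] by linarith
  have f_meas: "f \<in> borel_measurable lebesgue" unfolding f_def by measurable
  have f_nn: "0 \<le> f x" for x by (simp add: f_def)
  have fb: "\<bar>f x\<bar> \<le> (C + 1) / (h * z)" for x
    using C z h by (simp add: f_def)
  have zw: "(\<lambda>x. z * w x) \<in> Eplus E \<theta>" using w(1) z by (intro scaled_in_Eplus) auto
  have fF: "AE x in lebesgue. f x \<le> F (\<lambda>x. z * w x) x"
    using le[folded z_def] F_nonneg[OF zw]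
  proof eventually_elim
    case (elim x)
    then have "(v x - z * w x) / (h * z) \<le> F (\<lambda>x. z * w x) x"
      using h z by (simp add: pos_divide_le_eq algebra_simps)
    then show ?case using elim(2) by (simp add: f_def min_le_iff_disj)
  qed
  have f_step: "AE x in lebesgue. f x \<le> F (u (t + s)) x" if s: "0 < s" "s < h" for s
  proof -
    have Ms: "M * s \<le> M * h" "0 \<le> M * s" using s M_pos by auto
    have "AE x in lebesgue. (1 - M * s) * u t x \<le> u (t + s) x"
      using s h Ms by (intro sol_decay t) auto
    then have "AE x in lebesgue. z * w x \<le> u (t + s) x"
      using w(2) EplusD(2)[OF w(1)]
    proof eventually_elim
      case (elim x)
      have "z * w x \<le> (1 - M * s) * u t x"
        using elim z Ms by (intro mult_mono) (auto simp: z_def)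
      then show ?case using elim Ms h by simp
    qed
    then have "AE x in lebesgue. F (\<lambda>x. z * w x) x \<le> F (u (t + s)) x"
      using t s by (intro F_mono zw sol_range) auto
    with fF show ?thesis by eventually_elim simp
  qed
  have v_le: "AE x in lebesgue. v x \<le> z * u t x + h * z * f x"
    using w(2) EplusD(2)[OF w(1)]
  proof eventually_elim
    case (elim x)
    have "z * w x \<le> z * u t x" using elim z by simp
    moreover have "v x - z * w x \<le> C + 1"
      using v(2)[of x] elim z C by (smt (verit, best) mult_nonneg_nonneg)
    then have "(v x - z * w x) / (h * z) \<le> f x"
      unfolding f_def using h z by (simp add: min_def divide_right_mono)
    then have "v x - z * w x \<le> h * z * f x"
      using h z by (simp add: pos_divide_le_eq algebra_simps)
    ultimately show ?case by linarith
  qed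
  show ?thesis
  proof (rule AE_le_if_integral_le[where C = "max C \<theta>"])
    show "AE x in lebesgue. \<bar>v x\<bar> \<le> max C \<theta>" using v(2) by (simp add: le_max_iff_disj)
    show "AE x in lebesgue. \<bar>u (t + h) x\<bar> \<le> max C \<theta>"
      using sol_abs_bound[OF th] by eventually_elim simp
    fix A :: "'a set" assume A: "A \<in> lmeasurable"
    note [measurable] = fmeasurableD[OF A] f_meas
    have bd: "AE x in lebesgue. \<bar>z * u t x + h * z * f x\<bar> \<le> \<theta> + (C + 1)"
      using sol_AE_bounds[OF t]
    proof eventually_elim
      case (elim x)
      have "z * u t x \<le> \<theta>" "0 \<le> z * u t x" using elim z mult_left_le_one_le[of "u t x" z] by auto
      moreover have "h * z * f x \<le> C + 1" "0 \<le> h * z * f x"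
        using fb[of x] f_nn[of x] h z by (auto simp: pos_le_divide_eq algebra_simps)
      ultimately show ?case by linarith
    qed
    have "(\<integral>x. indicator A x * v x \<partial>lebesgue) \<le> (\<integral>x. indicator A x * (z * u t x + h * z * f x) \<partial>lebesgue)"
    proof (rule integral_mono_AE)
      show "integrable lebesgue (\<lambda>x. indicator A x * v x)"
        using v(2) by (intro integrable_indicator_mult(1)[OF A, of _ C]) auto
      show "integrable lebesgue (\<lambda>x. indicator A x * (z * u t x + h * z * f x))"
        by (intro integrable_indicator_mult(1)[OF A _ bd]) measurable
      show "AE x in lebesgue. indicator A x * v x \<le> indicator A x * (z * u t x + h * z * f x)"
        using v_le by eventually_elim (auto simp: indicator_def)
    qed
    also have "\<dots> \<le> (\<integral>x. indicator A x * u (t + h) x \<partial>lebesgue)"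
      using sol_integral_step[OF A t _ _ f_meas _ f_nn, of h, folded z_def] fb f_step h by force
    finally show "(\<integral>x. indicator A x * v x \<partial>lebesgue) \<le> (\<integral>x. indicator A x * u (t + h) x \<partial>lebesgue)" .
  qed measurable
qed

end

section \<open>Two elementary inequalities\<close>

text \<open>
  The right-hand side is the total mass of the linear one-step kernel at growth rate \<open>\<gamma>\<close>; for small
  time steps it exceeds 1.
\<close>

lemma amplification:
  fixes h \<gamma> :: real
  assumes h: "0 < h" and M: "0 < M" and \<gamma>: "0 < \<gamma>" and h1: "4 * M * (M + \<gamma>) * h \<le> \<gamma>"
    and z: "z = 1 - M * h"
  shows "1 + h * \<gamma> / 2 \<le> z + h * z\<^sup>2 * (M + \<gamma>)"
proof -
  have "1 - 2 * (M * h) \<le> z\<^sup>2" unfolding z by (simp add: power2_diff)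
  then have "(1 - 2 * (M * h)) * (h * (M + \<gamma>)) \<le> z\<^sup>2 * (h * (M + \<gamma>))"
    using h M \<gamma> by (intro mult_right_mono) auto
  then have "1 + h * \<gamma> - h * (2 * M * (M + \<gamma>) * h) \<le> z + h * z\<^sup>2 * (M + \<gamma>)"
    unfolding z by (simp add: algebra_simps)
  moreover have "h * (2 * M * (M + \<gamma>) * h) \<le> h * (\<gamma> / 2)" using h1 h by (intro mult_left_mono) auto
  ultimately show ?thesis by simp
qed

text \<open>
  Here \<open>q\<close> is the value of the paraboloid at a point, \<open>loss\<close> collects the curvature and drift errors,
  and \<open>gain\<close> is the contribution of the edge. If \<open>q\<close> is at least of order \<open>1 / L\<close>, the growth \<open>h \<gamma> q / 4\<close>
  covers the loss; otherwise the gain does.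
\<close>

lemma growth_dominates_loss:
  fixes h \<gamma> L :: real
  assumes h: "0 < h" and M: "0 < M" "M * h \<le> 1 / 2" and \<gamma>: "0 < \<gamma>" and L: "0 < L" and C: "1 \<le> C"
    and h1: "4 * M * (M + \<gamma>) * h \<le> \<gamma>" and h2: "32 * C * h \<le> \<gamma> * \<rho>" and h3: "4 * C * h \<le> \<kappa> * g"
    and \<rho>: "0 < \<rho>" and \<kappa>: "0 < \<kappa>" and g: "0 < g"
    and z: "z = 1 - M * h" and S: "S = z + h * z\<^sup>2 * (M + \<gamma>)"
    and q: "0 \<le> q" and loss: "loss \<le> C * h\<^sup>2 / L"
    and gain: "0 \<le> gain" "q \<le> \<rho> / (8 * L) \<Longrightarrow> g / L \<le> gain"
  shows "(1 + h * \<gamma> / 4) * q \<le> S * q - loss + h * z\<^sup>2 * \<kappa> * gain"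
proof -
  have zh: "1 / 4 \<le> z\<^sup>2"
  proof -
    have "(1/2)\<^sup>2 \<le> z\<^sup>2" using M z by (intro power_mono) auto
    then show ?thesis by (simp add: power2_eq_square)
  qed
  have "1 + h * \<gamma> / 2 \<le> S" unfolding S by (rule amplification[OF h M(1) \<gamma> h1 z])
  then have Sq: "(1 + h * \<gamma> / 2) * q \<le> S * q" using q by (intro mult_right_mono) auto
  have gn: "0 \<le> h * z\<^sup>2 * \<kappa> * gain" using h \<kappa> gain by simp
  show ?thesis
  proof (cases "q \<le> \<rho> / (8 * L)")
    case True
    have "C * h\<^sup>2 = h * (C * h)" by (simp add: power2_eq_square)
    also have "\<dots> \<le> h * (1 / 4 * \<kappa> * g)" using h h3 by (intro mult_left_mono) auto
    also have "\<dots> \<le> h * (z\<^sup>2 * \<kappa> * g)" using zh h \<kappa> g by (intro mult_left_mono mult_right_mono) auto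
    finally have "C * h\<^sup>2 / L \<le> h * (z\<^sup>2 * \<kappa> * g) / L" using L by (intro divide_right_mono) auto
    also have "\<dots> = h * z\<^sup>2 * \<kappa> * (g / L)" by simp
    also have "\<dots> \<le> h * z\<^sup>2 * \<kappa> * gain" using gain(2)[OF True] h \<kappa> by (intro mult_left_mono) auto
    finally have "loss \<le> h * z\<^sup>2 * \<kappa> * gain" using loss by linarith
    moreover have "(1 + h * \<gamma> / 4) * q \<le> (1 + h * \<gamma> / 2) * q" using q h \<gamma> by (intro mult_right_mono) auto
    ultimately show ?thesis using Sq by linarith
  next
    case False
    have "C * h\<^sup>2 = h * (C * h)" by (simp add: power2_eq_square)
    also have "\<dots> \<le> h * (\<gamma> * \<rho> / 32)" using h h2 by (intro mult_left_mono) auto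
    finally have "C * h\<^sup>2 / L \<le> h * (\<gamma> * \<rho> / 32) / L" using L by (intro divide_right_mono) auto
    also have "\<dots> = h * \<gamma> / 4 * (\<rho> / (8 * L))" by simp
    also have "\<dots> \<le> h * \<gamma> / 4 * q" using False h \<gamma> by (intro mult_left_mono) auto
    finally have "loss \<le> h * \<gamma> / 4 * q" using loss by linarith
    then show ?thesis using Sq gn by (simp add: algebra_simps)
  qed
qed

section \<open>The standing assumptions\<close>

text \<open>
  The hypotheses of the theorem with their existential constants made explicit. The constant \<open>p\<close> may
  be enlarged freely, so it is assumed to be at least \<open>q\<close> and \<open>l \<theta>\<close>.
\<close>

locale hair_trigger = nonlocal_equation E a u0 G u m \<kappa> \<theta> p
  for E :: space_kind and a u0 :: "'a::euclidean_space \<Rightarrow> real"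
    and G :: "('a \<Rightarrow> real) \<Rightarrow> ('a \<Rightarrow> real)" and u :: "real \<Rightarrow> 'a \<Rightarrow> real"
    and m \<kappa> \<theta> p :: real +
  fixes \<beta> l q \<delta> \<rho> :: real and b :: "'a \<Rightarrow> real"
  assumes beta_eq: "\<beta> = \<kappa> - m" and beta_pos: "0 < \<beta>"
    and G_space: "\<And>v. v \<in> space_of E \<Longrightarrow> G v \<in> space_of E"
    and G_zero: "eq_in E (G (\<lambda>_. 0)) (\<lambda>_. 0)"
    and G_ge: "\<And>v. v \<in> Eplus E \<theta> \<Longrightarrow> le_in E (G (\<lambda>_. 0)) (G v)"
    and l_pos: "0 < l"
    and G_lipschitz: "\<And>v w. v \<in> Eplus E \<theta> \<Longrightarrow> w \<in> Eplus E \<theta> \<Longrightarrow>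
      norm_in E (\<lambda>x. G v x - G w x) \<le> l * norm_in E (\<lambda>x. v x - w x)"
    and G_loc_unif: "\<And>vn v. (\<And>n. vn n \<in> Eplus E \<theta>) \<Longrightarrow> v \<in> Eplus E \<theta> \<Longrightarrow> loc_unif_conv E vn v \<Longrightarrow>
      loc_unif_conv E (\<lambda>n. G (vn n)) (G v)"
    and G_translate: "\<And>v y. v \<in> Eplus E \<theta> \<Longrightarrow> eq_in E (translate y (G v)) (G (translate y v))"
    and G_const_less: "\<And>r. 0 < r \<Longrightarrow> r < \<theta> \<Longrightarrow> forall_in E (\<lambda>x. G (\<lambda>_. r) x < \<beta>)"
    and a_moment: "integrable lebesgue (\<lambda>y. norm y * a y)"
    and rho_pos: "0 < \<rho>" and a_ge_rho: "AE x in lebesgue. x \<in> ball 0 \<rho> \<longrightarrow> \<rho> \<le> a x"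
    and delta_pos: "0 < \<delta>"
    and b_nonneg: "\<And>x. 0 \<le> b x" and b_measurable: "b \<in> borel_measurable lebesgue"
    and a_minus_b: "AE x in lebesgue. \<delta> * indicator (ball 0 \<delta>) x \<le> a x - b x"
    and G_le_b: "\<And>w. w \<in> Eplus E \<theta> \<Longrightarrow> le_in E (\<lambda>x. w x * G w x) (\<lambda>x. \<kappa> * conv b w x + q * w x)"
    and p_ge_q: "q \<le> p" and p_ge_l: "l * \<theta> \<le> p"
    and init: "not_identically_zero E u0" "u0 \<in> space_of E"
begin

section \<open>Positivity of the solution on large balls\<close>

lemma b_integrable: "integrable lebesgue b"
proof (rule Bochner_Integration.integrable_bound[OF a_int b_measurable])
  show "AE x in lebesgue. norm (b x) \<le> norm (a x)"
    using a_minus_b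
  proof eventually_elim
    case (elim x)
    moreover have "0 \<le> \<delta> * indicator (ball 0 \<delta>) x" using delta_pos by simp
    ultimately show ?case using b_nonneg[of x] by simp
  qed
qed

text \<open>
  The only use of the majorant \<open>\<kappa> b*w + q w\<close> of \<open>w Gw\<close>: since \<open>p \<ge> q\<close>, it leaves
  \<open>F w \<ge> \<kappa> (a - b)*w\<close>.
\<close>

lemma F_ge_ball_average:
  assumes w: "w \<in> Eplus E \<theta>"
  shows "AE x in lebesgue. \<kappa> * \<delta> * (\<integral>y. indicator (ball x \<delta>) y * w y \<partial>lebesgue) \<le> F w x"
proof -
  have bd: "AE x in lebesgue. \<bar>w x\<bar> \<le> \<theta>" using EplusD(2)[OF w] by eventually_elim simp
  have conv: "\<delta> * (\<integral>y. indicator (ball x \<delta>) y * w y \<partial>lebesgue) \<le> conv a w x - conv b w x" for x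
  proof -
    note ia = integrable_mult_AE_bounded[OF integrable_reflect[OF a_int, of x] EplusD(3)[OF w] bd]
    note ib = integrable_mult_AE_bounded[OF integrable_reflect[OF b_integrable, of x] EplusD(3)[OF w] bd]
    have ii: "integrable lebesgue (\<lambda>y. indicator (ball x \<delta>) y * w y)"
      by (rule integrable_indicator_mult(1)[OF lmeasurable_ball EplusD(3)[OF w] bd])
    have "(\<integral>y. \<delta> * (indicator (ball x \<delta>) y * w y) \<partial>lebesgue) \<le> (\<integral>y. a (x - y) * w y - b (x - y) * w y \<partial>lebesgue)"
    proof (rule integral_mono_AE)
      show "AE y in lebesgue. \<delta> * (indicator (ball x \<delta>) y * w y) \<le> a (x - y) * w y - b (x - y) * w y"
        using AE_lebesgue_shift(1)[OF a_minus_b, of x] EplusD(2)[OF w]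
      proof eventually_elim
        case (elim y)
        have "indicator (ball 0 \<delta>) (x - y) = (indicator (ball x \<delta>) y :: real)"
          by (simp add: indicator_def dist_norm norm_minus_commute)
        then have "\<delta> * indicator (ball x \<delta>) y * w y \<le> (a (x - y) - b (x - y)) * w y"
          using elim by (intro mult_right_mono) auto
        then show ?case by (simp add: algebra_simps)
      qed
    qed (use ia ib ii in auto)
    then show ?thesis using ia ib unfolding conv_def by simp
  qed
  have "AE x in lebesgue. w x * G w x \<le> \<kappa> * conv b w x + q * w x"
    using G_le_b[OF w] unfolding le_in_def by (rule forall_in_imp_AE)
  then show ?thesis
    using EplusD(2)[OF w]
  proof eventually_elim
    case (elim x)
    have "\<kappa> * (\<delta> * (\<integral>y. indicator (ball x \<delta>) y * w y \<partial>lebesgue)) \<le> \<kappa> * (conv a w x - conv b w x)"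
      using conv kappa_pos by (intro mult_left_mono) auto
    moreover have "q * w x \<le> p * w x" using elim p_ge_q by (intro mult_right_mono) auto
    ultimately show ?case using elim(1) by (simp add: F_def algebra_simps)
  qed
qed

text \<open>
  Even for centres slightly beyond the edge, the ball of radius \<open>\<delta>\<close> still contains a ball of
  radius \<open>s / 8\<close> on which the paraboloid exceeds a positive constant.
\<close>

lemma paraboloid_ball_average:
  fixes x :: 'a
  assumes s: "0 < s" "s \<le> \<delta>" "s \<le> L" and x: "norm x \<le> L + s / 4"
  shows "(1 - (L - s / 8)\<^sup>2 / L\<^sup>2) * measure lebesgue (ball (0::'a) (s / 8))
    \<le> (\<integral>y. indicator (ball x \<delta>) y * paraboloid L y \<partial>lebesgue)"
proof -
  \<comment> \<open>The radial contraction maps the ball of radius \<open>L + s / 4\<close> onto the one of radius \<open>L - s / 4\<close> and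
    moves no point by more than \<open>s / 2\<close>.\<close>
  define c where "c = ((L - s / 4) / (L + s / 4)) *\<^sub>R x"
  define \<eta> where "\<eta> = 1 - (L - s / 8)\<^sup>2 / L\<^sup>2"
  have L: "0 < L" using s by simp
  have c1: "norm c \<le> L - s / 4"
  proof -
    have "norm c = (L - s / 4) / (L + s / 4) * norm x" using s by (simp add: c_def)
    also have "\<dots> \<le> (L - s / 4) / (L + s / 4) * (L + s / 4)" using s x by (intro mult_left_mono) auto
    finally show ?thesis using s by simp
  qed
  have c2: "norm (c - x) \<le> s / 2"
  proof -
    have "(L - s / 4) / (L + s / 4) - 1 = - (s / 2 / (L + s / 4))" using s by (simp add: field_simps)
    then have "c - x = - (s / 2 / (L + s / 4)) *\<^sub>R x" unfolding c_def
      by (metis scaleR_left_diff_distrib scaleR_one)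
    then have "norm (c - x) = s / 2 / (L + s / 4) * norm x" using s by simp
    also have "\<dots> \<le> s / 2 / (L + s / 4) * (L + s / 4)" using s x by (intro mult_left_mono) auto
    also have "\<dots> = s / 2" using s by (simp del: divide_divide_eq_left)
    finally show ?thesis .
  qed
  have "\<eta> * indicator (ball c (s / 8)) y \<le> indicator (ball x \<delta>) y * paraboloid L y" for y
  proof (cases "y \<in> ball c (s / 8)")
    case True
    then have y: "norm (y - c) < s / 8" by (simp add: dist_norm norm_minus_commute)
    have "norm (y - x) \<le> norm (y - c) + norm (c - x)"
      using norm_triangle_ineq[of "y - c" "c - x"] by simp
    then have "y \<in> ball x \<delta>" using y c2 s by (simp add: dist_norm norm_minus_commute)
    moreover have "norm y \<le> L - s / 8"
      using norm_triangle_ineq[of "y - c" c] y c1 s by simp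
    then have "(norm y)\<^sup>2 / L\<^sup>2 \<le> (L - s / 8)\<^sup>2 / L\<^sup>2"
      by (intro divide_right_mono power_mono) auto
    then have "\<eta> \<le> paraboloid L y" using paraboloid_ge[of y L] unfolding \<eta>_def by linarith
    ultimately show ?thesis using True by simp
  qed (simp add: paraboloid_nonneg)
  moreover have "integrable lebesgue (\<lambda>y. \<eta> * indicator (ball c (s / 8)) y)"
    using lmeasurable_ball[of c "s / 8"] by (intro integrable_mult_right integrable_real_indicator) (auto simp: fmeasurable_def)
  moreover have "integrable lebesgue (\<lambda>y. indicator (ball x \<delta>) y * paraboloid L y)"
    by (intro integrable_indicator_mult(1)[of _ _ 1] lmeasurable_ball AE_I2 paraboloid_lebesgue_measurable)
      (simp_all add: abs_of_nonneg paraboloid_nonneg paraboloid_le_1)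
  ultimately have "(\<integral>y. \<eta> * indicator (ball c (s / 8)) y \<partial>lebesgue) \<le> (\<integral>y. indicator (ball x \<delta>) y * paraboloid L y \<partial>lebesgue)"
    by (intro integral_mono) auto
  moreover have "(\<integral>y. \<eta> * indicator (ball c (s / 8)) y \<partial>lebesgue) = \<eta> * measure lebesgue (ball c (s / 8))"
    by simp
  ultimately show ?thesis
    using s measure_lebesgue_ball(1)[of "s / 8" c] unfolding \<eta>_def by simp
qed

lemma positivity_step:
  assumes s: "0 < s" "s \<le> \<delta>" "s \<le> L" and h: "0 < h" "M * h < 1" and t: "0 \<le> t"
    and c: "0 < c" "c \<le> \<theta>" "AE x in lebesgue. c * paraboloid L (x - x0) \<le> u t x"
  shows "\<exists>c'>0. c' \<le> \<theta> \<and> (AE x in lebesgue. c' * paraboloid (L + s / 4) (x - x0) \<le> u (t + h) x)"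
proof -
  define z where "z = 1 - M * h"
  have z: "0 < z" "z \<le> 1" using h M_pos by (auto simp: z_def)
  have L: "0 < L" using s by simp
  define w where "w x = c * paraboloid L (x - x0)" for x
  define I where "I = (1 - (L - s / 8)\<^sup>2 / L\<^sup>2) * measure lebesgue (ball (0::'a) (s / 8))"
  have "(L - s / 8)\<^sup>2 < L\<^sup>2" using s by (intro power_strict_mono) auto
  then have I: "0 < I" using s L measure_lebesgue_ball(2)[of "s / 8" "0::'a"]
    unfolding I_def by (intro mult_pos_pos) (auto simp: divide_less_eq)
  define c' where "c' = min \<theta> (h * z * (\<kappa> * \<delta> * (z * c * I)))"
  have c': "0 < c'" "c' \<le> \<theta>"
    using theta_pos h z kappa_pos delta_pos c I by (auto simp: c'_def)
  have w: "w \<in> Eplus E \<theta>" unfolding w_def using c L by (intro scaled_paraboloid_in_Eplus) auto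
  have zw: "(\<lambda>x. z * w x) \<in> Eplus E \<theta>" using w z by (intro scaled_in_Eplus) auto
  have avg: "z * c * I \<le> (\<integral>y. indicator (ball x \<delta>) y * (z * w y) \<partial>lebesgue)" if "norm (x - x0) \<le> L + s / 4" for x
  proof -
    let ?f = "\<lambda>y. indicator (ball x \<delta>) y * paraboloid L (y - x0)"
    let ?g = "\<lambda>y. indicator (ball (x - x0) \<delta>) y * paraboloid L y"
    have "distr lebesgue lebesgue (\<lambda>y. - x0 + 1 *\<^sub>R y) = lebesgue"
      by (rule lebesgue_distr_reflect_translate(1)) simp
    moreover have "?g \<in> borel_measurable lebesgue"
      by (rule borel_measurable_times) (auto intro!: borel_measurable_indicator paraboloid_lebesgue_measurable fmeasurableD[OF lmeasurable_ball])
    ultimately have "integral\<^sup>L lebesgue ?g = (\<integral>y. ?g (- x0 + 1 *\<^sub>R y) \<partial>lebesgue)"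
      using integral_distr[OF lebesgue_distr_reflect_translate(2)[of 1 "- x0"], of ?g] by simp
    also have "\<dots> = integral\<^sup>L lebesgue ?f"
      by (intro Bochner_Integration.integral_cong) (auto simp: indicator_def dist_norm algebra_simps)
    finally have "I \<le> integral\<^sup>L lebesgue ?f"
      using paraboloid_ball_average[OF s that] by (simp add: I_def)
    then have "z * c * I \<le> z * c * integral\<^sup>L lebesgue ?f" using z c by (intro mult_left_mono) auto
    also have "\<dots> = (\<integral>y. indicator (ball x \<delta>) y * (z * w y) \<partial>lebesgue)"
      unfolding w_def by (subst integral_mult_right_zero[symmetric])
        (auto intro!: Bochner_Integration.integral_cong simp: mult_ac)
    finally show ?thesis .
  qed
  have "AE x in lebesgue. c' * paraboloid (L + s / 4) (x - x0) \<le> u (t + h) x"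
  proof (rule sol_step[OF t h w])
    show "AE x in lebesgue. w x \<le> u t x" using c(3) by (simp add: w_def)
    show "(\<lambda>x. c' * paraboloid (L + s / 4) (x - x0)) \<in> borel_measurable lebesgue"
      using paraboloid_lebesgue_measurable[of "L + s / 4"] by measurable
    show "\<bar>c' * paraboloid (L + s / 4) (x - x0)\<bar> \<le> c'" for x
      using c' paraboloid_nonneg[of "L + s / 4" "x - x0"] paraboloid_le_1[of "L + s / 4" "x - x0"]
      by (simp add: abs_mult mult_left_le)
    show "AE x in lebesgue. c' * paraboloid (L + s / 4) (x - x0)
        \<le> (1 - M * h) * w x + h * (1 - M * h) * F (\<lambda>x. (1 - M * h) * w x) x"
      unfolding z_def[symmetric] using F_ge_ball_average[OF zw] F_nonneg[OF zw]
    proof eventually_elim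
      case (elim x)
      have w0: "0 \<le> z * w x" using z c by (simp add: w_def paraboloid_nonneg)
      show ?case
      proof (cases "norm (x - x0) \<le> L + s / 4")
        case True
        have "c' * paraboloid (L + s / 4) (x - x0) \<le> c'"
          using c' paraboloid_le_1[of "L + s / 4" "x - x0"] by (simp add: mult_left_le)
        also have "\<dots> \<le> h * z * (\<kappa> * \<delta> * (z * c * I))" by (simp add: c'_def)
        also have "\<dots> \<le> h * z * (\<kappa> * \<delta> * (\<integral>y. indicator (ball x \<delta>) y * (z * w y) \<partial>lebesgue))"
          using h z kappa_pos delta_pos avg[OF True] by (intro mult_left_mono) auto
        also have "\<dots> \<le> h * z * F (\<lambda>x. z * w x) x"
          using h z elim(1) by (intro mult_left_mono) auto
        finally show ?thesis using w0 by linarith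
      next
        case False
        then have "paraboloid (L + s / 4) (x - x0) = 0" using L s by (intro paraboloid_eq_0) auto
        then show ?thesis using w0 elim(2) h z by simp
      qed
    qed
  qed
  then show ?thesis using c' by blast
qed

lemma initial_bump:
  "\<exists>x0 L c. 0 < L \<and> 0 < c \<and> c \<le> \<theta> \<and> (AE x in lebesgue. c * paraboloid L (x - x0) \<le> u 0 x)"
proof -
  have u0: "AE x in lebesgue. u 0 x = u0 x"
    using sol unfolding classical_solution_def eq_in_def by (blast intro: forall_in_imp_AE)
  have nn: "AE x in lebesgue. 0 \<le> u0 x"
    using u0 sol_AE_bounds[of 0, OF order_refl] by eventually_elim simp
  obtain x0 L where L: "0 < L" "AE x in lebesgue. x \<in> ball x0 L \<longrightarrow> L \<le> u0 x"
  proof (cases "E = Linf")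
    case True
    then show ?thesis using init that by (auto simp: not_identically_zero_def)
  next
    case False
    then obtain x0 where "u0 x0 \<noteq> 0" using init by (auto simp: not_identically_zero_def)
    have cont: "continuous_on UNIV u0" using space_of_continuous[OF init(2) False] .
    have "0 \<le> u0 x0" using AE_le_imp_le_continuous[OF _ cont, of "\<lambda>_. 0"] nn by simp
    then have pos: "0 < u0 x0" using \<open>u0 x0 \<noteq> 0\<close> by simp
    obtain d where d: "0 < d" "\<And>x. dist x x0 < d \<Longrightarrow> dist (u0 x) (u0 x0) < u0 x0 / 2"
      using cont pos unfolding continuous_on_iff by (metis UNIV_I half_gt_zero)
    show ?thesis
    proof (rule that[of "min d (u0 x0 / 2)"])
      show "AE x in lebesgue. x \<in> ball x0 (min d (u0 x0 / 2)) \<longrightarrow> min d (u0 x0 / 2) \<le> u0 x"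
      proof (intro AE_I2 impI)
        fix x assume "x \<in> ball x0 (min d (u0 x0 / 2))"
        then have "dist (u0 x) (u0 x0) < u0 x0 / 2" using d(2)[of x] by (simp add: dist_commute)
        then have "u0 x0 / 2 \<le> u0 x" unfolding dist_real_def by linarith
          then show "min d (u0 x0 / 2) \<le> u0 x" by simp
      qed
    qed (use d pos in auto)
  qed
  have "AE x in lebesgue. min \<theta> L * paraboloid L (x - x0) \<le> u 0 x"
    using L(2) u0 nn
  proof eventually_elim
    case (elim x)
    show ?case
    proof (cases "x \<in> ball x0 L")
      case True
      have "min \<theta> L * paraboloid L (x - x0) \<le> min \<theta> L"
        using L theta_pos by (intro mult_left_le paraboloid_le_1) auto
      then show ?thesis using elim True by simp
    next
      case False
      then have "paraboloid L (x - x0) = 0" using L by (intro paraboloid_eq_0) (auto simp: dist_norm norm_minus_commute)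
      then show ?thesis using elim by simp
    qed
  qed
  then show ?thesis using L theta_pos by (intro exI[of _ x0] exI[of _ L] exI[of _ "min \<theta> L"]) auto
qed

text \<open>
  The starting time \<open>T\<close> does not depend on the radius \<open>R\<close>. This matters below, where \<open>R\<close> has to
  be at least \<open>L + (T + h) |D|\<close>.
\<close>

lemma positive_on_ball:
  assumes T: "0 < T" and h: "0 \<le> h" "M * h < 1"
  shows "\<exists>c>0. \<forall>t\<in>{T..T + h}. AE x in lebesgue. norm x \<le> R \<longrightarrow> c \<le> u t x"
proof -
  obtain x0 L c where init: "0 < L" "0 < c" "c \<le> \<theta>" "AE x in lebesgue. c * paraboloid L (x - x0) \<le> u 0 x"
    using initial_bump by blast
  define s where "s = min \<delta> L"
  have s: "0 < s" "s \<le> \<delta>" "s \<le> L" using init delta_pos by (auto simp: s_def)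
  have iter: "\<exists>c>0. c \<le> \<theta> \<and> (AE x in lebesgue. c * paraboloid (L + n * (s / 4)) (x - x0) \<le> u (n * k) x)"
    if k: "0 < k" "M * k < 1" for k :: real and n :: nat
  proof (induction n)
    case 0
    then show ?case using init by auto
  next
    case (Suc n)
    then obtain c where c: "0 < c" "c \<le> \<theta>" "AE x in lebesgue. c * paraboloid (L + n * (s / 4)) (x - x0) \<le> u (n * k) x"
      by blast
    have "s \<le> L + n * (s / 4)" using s by (simp add: add_increasing2)
    from positivity_step[OF s(1,2) this k _ c] k
    have "\<exists>c'>0. c' \<le> \<theta> \<and> (AE x in lebesgue. c' * paraboloid (L + n * (s / 4) + s / 4) (x - x0) \<le> u (n * k + k) x)"
      by simp
    moreover have "L + n * (s / 4) + s / 4 = L + Suc n * (s / 4)" "n * k + k = Suc n * k"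
      by (simp_all add: algebra_simps)
    ultimately show ?case by metis
  qed
  \<comment> \<open>\<open>n\<close> steps of length \<open>T / n\<close>: the radius grows by \<open>s / 4\<close> in each of them, however short they are.\<close>
  obtain n :: nat where n: "max (max ((2 * (R + norm x0) + 1) / (s / 4)) (M * T)) 1 < n"
    using reals_Archimedean2 by blast
  define L' where "L' = L + n * (s / 4)"
  have L': "2 * (R + norm x0) < L'" "0 < L'"
    using n s init unfolding L'_def by (auto simp: divide_less_eq intro: add_pos_nonneg)
  have "0 < T / n" "M * (T / n) < 1" "n * (T / n) = T" using n T by auto
  with iter[of "T / n" n] obtain c where c: "0 < c" "AE x in lebesgue. c * paraboloid L' (x - x0) \<le> u T x"
    unfolding L'_def by auto
  have Mh: "0 \<le> M * h" "0 < 1 - M * h" using h M_pos by auto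
  have "\<forall>t\<in>{T..T + h}. AE x in lebesgue. norm x \<le> R \<longrightarrow> (1 - M * h) * (c * (3 / 4)) \<le> u t x"
  proof
    fix t assume t: "t \<in> {T..T + h}"
    define r where "r = t - T"
    have r: "0 \<le> r" "r \<le> h" "t = T + r" using t by (auto simp: r_def)
    have Mr: "M * r \<le> M * h" using r M_pos by simp
    have decay: "AE x in lebesgue. (1 - M * r) * u T x \<le> u (T + r) x"
      using r Mr h T by (intro sol_decay) auto
    show "AE x in lebesgue. norm x \<le> R \<longrightarrow> (1 - M * h) * (c * (3 / 4)) \<le> u t x"
      unfolding r(3) using decay c(2)
    proof eventually_elim
      case (elim x)
      show ?case
      proof
        assume x: "norm x \<le> R"
        have "norm (x - x0) \<le> R + norm x0" using norm_triangle_ineq4[of x x0] x by simp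
        then have "norm (x - x0) \<le> L' / 2" using L' by simp
        then have "3 / 4 \<le> paraboloid L' (x - x0)" using L' by (intro paraboloid_ge_on_half_ball)
        then have "c * (3 / 4) \<le> c * paraboloid L' (x - x0)" using c by (intro mult_left_mono) auto
        then have "c * (3 / 4) \<le> u T x" using elim by linarith
        then have "(1 - M * h) * (c * (3 / 4)) \<le> (1 - M * r) * u T x"
          using Mh Mr c h by (intro mult_mono) auto
        then show "(1 - M * h) * (c * (3 / 4)) \<le> u (T + r) x" using elim by linarith
      qed
    qed
  qed
  moreover have "0 < (1 - M * h) * (c * (3 / 4))" using c Mh by simp
  ultimately show ?thesis by blast
qed

section \<open>Growth of a paraboloid that moves with the mean drift\<close>

abbreviation (input) D :: 'a where "D \<equiv> drift \<kappa> a"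

text \<open>
  The first moment of the kernel; the drift is \<open>\<kappa>\<close> times this vector.
\<close>

definition mean :: 'a where "mean = (\<integral>y. a y *\<^sub>R y \<partial>lebesgue)"

lemma drift_eq: "D = \<kappa> *\<^sub>R mean"
  by (simp add: drift_def mean_def)

lemma integrable_first_moment: "integrable lebesgue (\<lambda>y. a y *\<^sub>R y)"
proof (rule Bochner_Integration.integrable_bound[OF a_moment])
  have "(\<lambda>y::'a. y) \<in> borel_measurable lebesgue" by (rule measurable_completion) simp
  then show "(\<lambda>y. a y *\<^sub>R y) \<in> borel_measurable lebesgue" by measurable
  show "AE y in lebesgue. norm (a y *\<^sub>R y) \<le> norm (norm y * a y)"
    by (simp add: abs_mult mult.commute)
qed

text \<open>
  \<open>L\<close> times the error of the tangent plane comparison in \<open>paraboloid_ge_tangent\<close>, averaged with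
  the kernel.
\<close>

definition tangent_error :: "'a \<Rightarrow> real \<Rightarrow> real" where
  "tangent_error d L = (\<integral>y. a y * min ((norm (d - y))\<^sup>2 / L) (4 * norm (d - y)) \<partial>lebesgue)"

lemma norm_shift_measurable: "(\<lambda>y::'a. norm (d - y)) \<in> borel_measurable lebesgue"
  by (rule measurable_completion) measurable

lemma integrable_a_norm: "integrable lebesgue (\<lambda>y. a y * (4 * norm (d - y)))"
proof (rule Bochner_Integration.integrable_bound)
  show "integrable lebesgue (\<lambda>y. 4 * (norm d * a y + norm y * a y))" using a_int a_moment by simp
  show "(\<lambda>y. a y * (4 * norm (d - y))) \<in> borel_measurable lebesgue"
    using norm_shift_measurable[of d] by measurable
  show "AE y in lebesgue. norm (a y * (4 * norm (d - y))) \<le> norm (4 * (norm d * a y + norm y * a y))"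
    using a_nonneg
  proof eventually_elim
    case (elim y)
    have "a y * norm (d - y) \<le> a y * (norm d + norm y)"
      using elim norm_triangle_ineq4 by (intro mult_left_mono)
    moreover have "0 \<le> norm d * a y" "0 \<le> norm y * a y" using elim by auto
    ultimately show ?case using elim by (simp add: algebra_simps)
  qed
qed

lemma tangent_error_integrable:
  assumes "0 < L"
  shows "integrable lebesgue (\<lambda>y. a y * min ((norm (d - y))\<^sup>2 / L) (4 * norm (d - y)))"
proof (rule Bochner_Integration.integrable_bound[OF integrable_a_norm[of d]])
  show "(\<lambda>y. a y * min ((norm (d - y))\<^sup>2 / L) (4 * norm (d - y))) \<in> borel_measurable lebesgue"
    using norm_shift_measurable[of d] by measurable
  have "\<bar>min ((norm (d - y))\<^sup>2 / L) (4 * norm (d - y))\<bar> \<le> 4 * norm (d - y)" for y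
    using assms by (simp add: min_def)
  then show "AE y in lebesgue. norm (a y * min ((norm (d - y))\<^sup>2 / L) (4 * norm (d - y))) \<le> norm (a y * (4 * norm (d - y)))"
    by (simp add: abs_mult mult_left_mono)
qed

lemma tangent_error_tendsto_0: "(tangent_error d \<longlongrightarrow> 0) at_top"
proof -
  have "((\<lambda>L. \<integral>y. a y * min ((norm (d - y))\<^sup>2 / L) (4 * norm (d - y)) \<partial>lebesgue) \<longlongrightarrow> (\<integral>y. 0 \<partial>(lebesgue :: 'a measure))) at_top"
  proof (rule integral_dominated_convergence_at_top[where w = "\<lambda>y. \<bar>a y * (4 * norm (d - y))\<bar>"])
    show "integrable lebesgue (\<lambda>y. \<bar>a y * (4 * norm (d - y))\<bar>)"
      using integrable_a_norm[of d] by (rule Bochner_Integration.integrable_abs)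
    show "(\<lambda>y. a y * min ((norm (d - y))\<^sup>2 / L) (4 * norm (d - y))) \<in> borel_measurable lebesgue" for L
      using norm_shift_measurable[of d] by measurable
    have b: "\<bar>min ((norm (d - y))\<^sup>2 / L) (4 * norm (d - y))\<bar> \<le> 4 * norm (d - y)" if "0 < L" for y L
      using that by (simp add: min_def)
    have "AE y in lebesgue. norm (a y * min ((norm (d - y))\<^sup>2 / L) (4 * norm (d - y))) \<le> \<bar>a y * (4 * norm (d - y))\<bar>"
      if "0 < L" for L
      using b[OF that] by (simp add: abs_mult mult_left_mono)
    then show "\<forall>\<^sub>F L in at_top. AE y in lebesgue. norm (a y * min ((norm (d - y))\<^sup>2 / L) (4 * norm (d - y))) \<le> \<bar>a y * (4 * norm (d - y))\<bar>"
      using eventually_gt_at_top[of 0] by (rule eventually_mono[rotated])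
    have "((\<lambda>L. a y * min ((norm (d - y))\<^sup>2 / L) (4 * norm (d - y))) \<longlongrightarrow> 0) at_top" for y
    proof -
      have "((\<lambda>L. (norm (d - y))\<^sup>2 / L) \<longlongrightarrow> 0) at_top"
        by (intro real_tendsto_divide_at_top[OF tendsto_const] filterlim_ident)
      then have "((\<lambda>L. min ((norm (d - y))\<^sup>2 / L) (4 * norm (d - y))) \<longlongrightarrow> min 0 (4 * norm (d - y))) at_top"
        by (rule tendsto_min) (rule tendsto_const)
      then have "((\<lambda>L. min ((norm (d - y))\<^sup>2 / L) (4 * norm (d - y))) \<longlongrightarrow> 0) at_top" by simp
      then show ?thesis by (rule tendsto_mult_right_zero)
    qed
    then show "AE y in lebesgue. ((\<lambda>L. a y * min ((norm (d - y))\<^sup>2 / L) (4 * norm (d - y))) \<longlongrightarrow> 0) at_top"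
      by simp
  qed simp
  then show ?thesis by (simp add: tangent_error_def[abs_def])
qed

text \<open>
  A lower bound for \<open>L\<close> times the gain at the edge: the kernel is at least \<open>\<rho>\<close> on a ball of radius
  \<open>\<rho> / 4\<close> of displacements pointing outwards, and each of these contributes at least \<open>\<rho> / (4 L)\<close>.
\<close>

definition edge_gain :: real where
  "edge_gain = \<rho>\<^sup>2 / 4 * measure lebesgue (ball (0::'a) (\<rho> / 4))"

lemma edge_gain_pos: "0 < edge_gain"
  using rho_pos measure_lebesgue_ball(2)[of "\<rho> / 4" "0::'a"] by (simp add: edge_gain_def)

lemma conv_paraboloid_ge:
  fixes x d :: 'a
  assumes L: "0 < L" "\<rho> \<le> L" and x: "norm x \<le> L" and d: "norm d \<le> \<rho> / 8"
  shows "\<exists>gain\<ge>0. (1 - (norm x)\<^sup>2 / L\<^sup>2 \<le> \<rho> / (8 * L) \<longrightarrow> edge_gain / L \<le> gain) \<and>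
    1 - (norm x)\<^sup>2 / L\<^sup>2 + 2 * (x \<bullet> (mean - d)) / L\<^sup>2 - tangent_error d L / L + gain
      \<le> conv a (paraboloid L) (x + d)"
proof -
  define q where "q = 1 - (norm x)\<^sup>2 / L\<^sup>2"
  define c where "c = (3 * \<rho> / (4 * norm x)) *\<^sub>R x"
  define B where "B = (if q \<le> \<rho> / (8 * L) then ball (- c) (\<rho> / 4) else {})"
  define e where "e y = min ((norm (d - y))\<^sup>2 / L) (4 * norm (d - y)) / L" for y
  have e0: "0 \<le> e y" for y using L by (simp add: e_def)
  have B: "B \<in> lmeasurable" by (simp add: B_def)
  have y_B: "q - 2 * (x \<bullet> (d - y)) / L\<^sup>2 \<le> - (\<rho> / (4 * L))" "norm y < \<rho>" if "y \<in> B" for y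
  proof -
    have q: "q \<le> \<rho> / (8 * L)" and yb: "y \<in> ball (- c) (\<rho> / 4)"
      using that by (auto simp: B_def split: if_splits)
    have "dist (- c) y = norm (y + c)"
      unfolding dist_norm by (metis minus_add_distrib norm_minus_cancel add.commute uminus_add_conv_diff add_uminus_conv_diff)
    with yb have y: "norm (y + c) < \<rho> / 4" by simp
    show "q - 2 * (x \<bullet> (d - y)) / L\<^sup>2 \<le> - (\<rho> / (4 * L))"
      unfolding q_def using y
      by (intro paraboloid_tangent_negative[OF rho_pos L(2) x q[unfolded q_def] _ d]) (simp add: c_def)
    have "norm c \<le> 3 * \<rho> / 4" using rho_pos by (simp add: c_def)
    then show "norm y < \<rho>" using y norm_triangle_ineq4[of "y + c" c] by simp
  qed
  have tangent: "q - 2 * (x \<bullet> (d - y)) / L\<^sup>2 - e y + \<rho> / (4 * L) * indicator B y \<le> paraboloid L (x + d - y)" for y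
  proof (cases "y \<in> B")
    case True
    then show ?thesis using y_B(1)[OF True] e0[of y] paraboloid_nonneg[of L "x + d - y"] by simp
  next
    case False
    then show ?thesis
      using paraboloid_ge_tangent[OF L(1) x, of "d - y"] by (simp add: q_def e_def add_diff_eq)
  qed
  define gain where "gain = \<rho> / (4 * L) * (\<integral>y. indicator B y * a y \<partial>lebesgue)"
  have ie: "integrable lebesgue (\<lambda>y. a y * e y)"
    using tangent_error_integrable[OF L(1), of d] unfolding e_def by simp
  have iB: "integrable lebesgue (\<lambda>y. indicator B y * a y)"
    using integrable_real_mult_indicator[OF fmeasurableD[OF B] a_int] by (simp add: mult.commute)
  have ix: "integrable lebesgue (\<lambda>y. x \<bullet> (a y *\<^sub>R y))"
    using integrable_first_moment by (rule integrable_inner_right)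
  have "(\<integral>y. (q - 2 * (x \<bullet> d) / L\<^sup>2) * a y + 2 / L\<^sup>2 * (x \<bullet> (a y *\<^sub>R y)) - a y * e y + \<rho> / (4 * L) * (indicator B y * a y) \<partial>lebesgue)
     \<le> (\<integral>y. a y * paraboloid L (x + d - y) \<partial>lebesgue)"
  proof (rule integral_mono_AE)
    show "integrable lebesgue (\<lambda>y. a y * paraboloid L (x + d - y))"
    proof (rule integrable_mult_bounded[OF a_int])
      show "(\<lambda>y. paraboloid L (x + d - y)) \<in> borel_measurable lebesgue"
        using paraboloid_lebesgue_measurable[of L] by measurable
      show "\<bar>paraboloid L (x + d - y)\<bar> \<le> 1" for y by (simp add: abs_of_nonneg paraboloid_nonneg paraboloid_le_1)
    qed
    show "AE y in lebesgue. (q - 2 * (x \<bullet> d) / L\<^sup>2) * a y + 2 / L\<^sup>2 * (x \<bullet> (a y *\<^sub>R y)) - a y * e y + \<rho> / (4 * L) * (indicator B y * a y)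
        \<le> a y * paraboloid L (x + d - y)"
      using a_nonneg
    proof eventually_elim
      case (elim y)
      have "a y * (q - 2 * (x \<bullet> (d - y)) / L\<^sup>2 - e y + \<rho> / (4 * L) * indicator B y) \<le> a y * paraboloid L (x + d - y)"
        using elim tangent by (intro mult_left_mono)
      moreover have "a y * (q - 2 * (x \<bullet> (d - y)) / L\<^sup>2 - e y + \<rho> / (4 * L) * indicator B y)
        = (q - 2 * (x \<bullet> d) / L\<^sup>2) * a y + 2 / L\<^sup>2 * (x \<bullet> (a y *\<^sub>R y)) - a y * e y + \<rho> / (4 * L) * (indicator B y * a y)"
        by (simp add: inner_simps algebra_simps diff_divide_distrib)
      ultimately show ?case by simp
    qed
  qed (use ie iB ix a_int in auto)
  moreover have "(\<integral>y. (q - 2 * (x \<bullet> d) / L\<^sup>2) * a y + 2 / L\<^sup>2 * (x \<bullet> (a y *\<^sub>R y)) - a y * e y + \<rho> / (4 * L) * (indicator B y * a y) \<partial>lebesgue)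
     = q - 2 * (x \<bullet> d) / L\<^sup>2 + 2 / L\<^sup>2 * (x \<bullet> mean) - tangent_error d L / L + gain"
  proof -
    have "(\<integral>y. x \<bullet> (a y *\<^sub>R y) \<partial>lebesgue) = x \<bullet> mean"
      unfolding mean_def using integrable_first_moment by (rule integral_inner_right)
    moreover have "(\<integral>y. a y * e y \<partial>lebesgue) = tangent_error d L / L"
      unfolding tangent_error_def e_def by simp
    ultimately show ?thesis using ie iB ix a_int a_mass by (simp add: gain_def)
  qed
  moreover have "conv a (paraboloid L) (x + d) = (\<integral>y. a y * paraboloid L (x + d - y) \<partial>lebesgue)"
    by (intro conv_commute a_measurable paraboloid_lebesgue_measurable)
  ultimately have main: "q + 2 * (x \<bullet> (mean - d)) / L\<^sup>2 - tangent_error d L / L + gain \<le> conv a (paraboloid L) (x + d)"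
    by (simp add: inner_simps diff_divide_distrib right_diff_distrib)
  have "0 \<le> (\<integral>y. indicator B y * a y \<partial>lebesgue)"
    using a_nonneg by (intro integral_nonneg_AE) (auto elim!: eventually_mono)
  then have "0 \<le> gain" using rho_pos L by (simp add: gain_def)
  moreover have "edge_gain / L \<le> gain" if "q \<le> \<rho> / (8 * L)"
  proof -
    have "(\<integral>y. \<rho> * indicator B y \<partial>lebesgue) \<le> (\<integral>y. indicator B y * a y \<partial>lebesgue)"
    proof (rule integral_mono_AE)
      show "AE y in lebesgue. \<rho> * indicator B y \<le> indicator B y * a y"
        using a_ge_rho by eventually_elim (auto simp: indicator_def y_B(2))
      show "integrable lebesgue (\<lambda>y. \<rho> * indicator B y)"
        using B by (intro integrable_mult_right integrable_real_indicator) (auto simp: fmeasurable_def)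
    qed (rule iB)
    moreover have "(\<integral>y. \<rho> * indicator B y \<partial>lebesgue) = \<rho> * measure lebesgue (ball (0::'a) (\<rho> / 4))"
      using that rho_pos measure_lebesgue_ball(1)[of "\<rho> / 4"] by (simp add: B_def)
    ultimately have "\<rho> / (4 * L) * (\<rho> * measure lebesgue (ball (0::'a) (\<rho> / 4))) \<le> gain"
      unfolding gain_def using rho_pos L by (intro mult_left_mono) auto
    then show ?thesis by (simp add: edge_gain_def power2_eq_square)
  qed
  ultimately show ?thesis using main unfolding q_def by blast
qed

text \<open>
  On functions with values in \<open>[0, r]\<close> the operator \<open>F\<close> dominates a linear one.
\<close>

lemma F_ge_linear:
  assumes w: "w \<in> Eplus E \<theta>" "\<And>x. 0 \<le> w x" "\<And>x. w x \<le> r"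
  shows "AE x in lebesgue. \<kappa> * conv a w x + (p - l * r) * w x \<le> F w x"
proof -
  have z: "(\<lambda>_. 0) \<in> Eplus E \<theta>" using theta_pos by (intro const_in_Eplus) auto
  have "norm_in E (\<lambda>x. w x - 0) \<le> r"
    using w EplusD(3)[OF w(1)] by (intro norm_in_le) (auto simp: abs_of_nonneg)
  then have n: "norm_in E (\<lambda>x. G w x - G (\<lambda>_. 0) x) \<le> l * r"
    using G_lipschitz[OF w(1) z] l_pos by (smt (verit, best) mult_left_mono)
  have "(\<lambda>x. G w x - G (\<lambda>_. 0) x) \<in> space_of E"
    by (intro space_of_diff G_space EplusD(1)[OF w(1)] EplusD(1)[OF z])
  then have "AE x in lebesgue. \<bar>G w x - G (\<lambda>_. 0) x\<bar> \<le> norm_in E (\<lambda>x. G w x - G (\<lambda>_. 0) x)"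
    by (rule AE_le_norm_in)
  then show ?thesis
    using forall_in_imp_AE[OF G_zero[unfolded eq_in_def]]
  proof eventually_elim
    case (elim x)
    then have "G w x \<le> l * r" using n by linarith
    then have "w x * G w x \<le> w x * (l * r)" using w(2) by (intro mult_left_mono)
    then show ?case by (simp add: F_def algebra_simps)
  qed
qed

text \<open>
  One step of the linear dynamics, in the frame moving with the drift \<open>D\<close>, multiplies the
  paraboloid by at least \<open>1 + h \<gamma> / 4\<close>.
\<close>

lemma paraboloid_step_lower_bound:
  fixes x :: 'a
  assumes h: "0 < h" "M * h \<le> 1 / 2" and \<gamma>: "0 < \<gamma>" "\<gamma> = \<beta> - l * r" and r: "l * r \<le> p"
    and C: "C = 2 * norm D * (2 * M + \<gamma>) + 1"
    and h1: "4 * M * (M + \<gamma>) * h \<le> \<gamma>" and h2: "32 * C * h \<le> \<gamma> * \<rho>" and h3: "4 * C * h \<le> \<kappa> * edge_gain"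
    and h4: "norm (h *\<^sub>R D) \<le> \<rho> / 8"
    and z: "z = 1 - M * h" and \<alpha>: "\<alpha> = z + h * z\<^sup>2 * (p - l * r)"
    and L: "0 < L" "\<rho> \<le> L"
    and err: "\<alpha> * (norm (h *\<^sub>R D))\<^sup>2 / L + h * z\<^sup>2 * \<kappa> * tangent_error (h *\<^sub>R D) L \<le> h\<^sup>2"
  shows "(1 + h * \<gamma> / 4) * paraboloid L x
    \<le> \<alpha> * paraboloid L (x + h *\<^sub>R D) + h * z\<^sup>2 * (\<kappa> * conv a (paraboloid L) (x + h *\<^sub>R D))"
proof -
  have z01: "0 < z" "z \<le> 1" using h z M_pos by auto
  have \<alpha>0: "0 \<le> \<alpha>" using \<alpha> z01 h r by simp
  define s where "s = h * z\<^sup>2 * \<kappa>"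
  have s0: "0 \<le> s" using h kappa_pos by (simp add: s_def)
  define d where "d = h *\<^sub>R D"
  show ?thesis
  proof (cases "norm x \<le> L")
    case False
    have "0 \<le> conv a (paraboloid L) (x + h *\<^sub>R D)"
      unfolding conv_commute[OF a_measurable paraboloid_lebesgue_measurable]
      using a_nonneg by (intro integral_nonneg_AE) (auto elim!: eventually_mono simp: paraboloid_nonneg)
    then have "0 \<le> h * z\<^sup>2 * (\<kappa> * conv a (paraboloid L) (x + h *\<^sub>R D))"
      using h kappa_pos by simp
    moreover have "0 \<le> \<alpha> * paraboloid L (x + h *\<^sub>R D)" using \<alpha>0 by (simp add: paraboloid_nonneg)
    ultimately show ?thesis using False L by (simp add: paraboloid_eq_0)
  next
    case True
    define q where "q = 1 - (norm x)\<^sup>2 / L\<^sup>2"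
    have q: "paraboloid L x = q" using paraboloid_eq[OF L(1) True] by (simp add: q_def)
    obtain gain where gain: "0 \<le> gain" "q \<le> \<rho> / (8 * L) \<longrightarrow> edge_gain / L \<le> gain"
      "q + 2 * (x \<bullet> (mean - d)) / L\<^sup>2 - tangent_error d L / L + gain \<le> conv a (paraboloid L) (x + d)"
      using conv_paraboloid_ge[OF L True h4] unfolding q_def d_def by blast
    define S where "S = z + h * z\<^sup>2 * (M + \<gamma>)"
    have S_eq: "\<alpha> + s = S"
      by (simp add: S_def \<alpha> s_def \<gamma>(2) beta_eq M_def algebra_simps)
    define loss where "loss = \<alpha> * (2 * (x \<bullet> d) / L\<^sup>2 + (norm d)\<^sup>2 / L\<^sup>2) - s * (2 * (x \<bullet> (mean - d)) / L\<^sup>2 - tangent_error d L / L)"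
    have 1: "q - 2 * (x \<bullet> d) / L\<^sup>2 - (norm d)\<^sup>2 / L\<^sup>2 \<le> paraboloid L (x + d)"
    proof -
      have "min ((norm d)\<^sup>2 / L) (4 * norm d) / L \<le> (norm d)\<^sup>2 / L / L" using L by (intro divide_right_mono) auto
      also have "\<dots> = (norm d)\<^sup>2 / L\<^sup>2" by (simp add: power2_eq_square)
      finally show ?thesis using paraboloid_ge_tangent[OF L(1) True, of d] unfolding q_def by linarith
    qed
    have sum: "S * q - loss + s * gain \<le> \<alpha> * paraboloid L (x + d) + s * conv a (paraboloid L) (x + d)"
      using mult_left_mono[OF 1 \<alpha>0] mult_left_mono[OF gain(3) s0]
      unfolding loss_def S_eq[symmetric] by (simp add: algebra_simps)
    have "loss \<le> C * h\<^sup>2 / L"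
    proof -
      have Sz: "S - z\<^sup>2 = h * (z * M + z\<^sup>2 * (M + \<gamma>))"
        unfolding S_def by (simp add: z power2_eq_square algebra_simps)
      have "z\<^sup>2 \<le> 1" using z01 by (simp add: power_le_one)
      then have "z * M + z\<^sup>2 * (M + \<gamma>) \<le> 1 * M + 1 * (M + \<gamma>)"
        using z01 M_pos \<gamma> by (intro add_mono mult_right_mono) auto
      then have "h * (z * M + z\<^sup>2 * (M + \<gamma>)) \<le> h * (2 * M + \<gamma>)" using h by (intro mult_left_mono) auto
      then have Sz1: "S - z\<^sup>2 \<le> h * (2 * M + \<gamma>)" unfolding Sz .
      have Sz0: "0 \<le> S - z\<^sup>2" unfolding Sz using h z01 M_pos \<gamma> by simp
      have xD: "x \<bullet> D \<le> L * norm D"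
        using Cauchy_Schwarz_ineq2[of x D] True mult_right_mono[of "norm x" L "norm D"] by simp
      \<comment> \<open>The one-step kernel has the first moment \<open>h z\<^sup>2 D\<close>, whereas its mass \<open>S\<close> moving with the frame
        has the moment \<open>S h D\<close>; the mismatch \<open>h (S - z\<^sup>2) D\<close> is of second order in \<open>h\<close>.\<close>
      have sm: "s *\<^sub>R mean = (h * z\<^sup>2) *\<^sub>R D" by (simp add: s_def drift_eq)
      have "\<alpha> * (x \<bullet> d) - s * (x \<bullet> (mean - d)) = S * (x \<bullet> d) - x \<bullet> (s *\<^sub>R mean)"
        unfolding S_eq[symmetric] by (simp add: inner_simps algebra_simps)
      also have "\<dots> = h * ((S - z\<^sup>2) * (x \<bullet> D))"
        unfolding sm d_def by (simp add: algebra_simps)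
      also have "\<dots> \<le> h * (h * (2 * M + \<gamma>) * (L * norm D))"
      proof (rule mult_left_mono)
        have "(S - z\<^sup>2) * (x \<bullet> D) \<le> (S - z\<^sup>2) * (L * norm D)" using Sz0 xD by (rule mult_left_mono[rotated])
        also have "\<dots> \<le> h * (2 * M + \<gamma>) * (L * norm D)" using Sz1 L by (intro mult_right_mono) auto
        finally show "(S - z\<^sup>2) * (x \<bullet> D) \<le> h * (2 * M + \<gamma>) * (L * norm D)" .
      qed (use h in simp)
      also have "\<dots> = (C - 1) * h\<^sup>2 * L / 2" unfolding C by (simp add: power2_eq_square)
      finally have "(\<alpha> * (x \<bullet> d) - s * (x \<bullet> (mean - d))) * (2 / L\<^sup>2) \<le> (C - 1) * h\<^sup>2 * L / 2 * (2 / L\<^sup>2)"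
        by (rule mult_right_mono) simp
      also have "\<dots> = (C - 1) * h\<^sup>2 / L" using L by (simp add: power2_eq_square)
      finally have A: "(\<alpha> * (x \<bullet> d) - s * (x \<bullet> (mean - d))) * (2 / L\<^sup>2) \<le> (C - 1) * h\<^sup>2 / L" .
      have "(\<alpha> * (norm d)\<^sup>2 / L + s * tangent_error d L) / L \<le> h\<^sup>2 / L"
        using err L unfolding d_def s_def by (intro divide_right_mono) auto
      moreover have "loss = (\<alpha> * (x \<bullet> d) - s * (x \<bullet> (mean - d))) * (2 / L\<^sup>2) + (\<alpha> * (norm d)\<^sup>2 / L + s * tangent_error d L) / L"
        unfolding loss_def by (simp add: add_divide_distrib diff_divide_distrib algebra_simps power2_eq_square)
      moreover have "(C - 1) * h\<^sup>2 / L + h\<^sup>2 / L = C * h\<^sup>2 / L" by (simp add: algebra_simps add_divide_distrib[symmetric])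
      ultimately show ?thesis using A by linarith
    qed
    moreover have "1 \<le> C" using M_pos \<gamma> by (simp add: C)
    moreover have "0 \<le> q" using q paraboloid_nonneg[of L x] by simp
    ultimately have "(1 + h * \<gamma> / 4) * q \<le> S * q - loss + h * z\<^sup>2 * \<kappa> * gain"
      using h \<gamma> L h1 h2 h3 rho_pos kappa_pos edge_gain_pos M_pos z S_def gain(1,2)
      by (intro growth_dominates_loss[of h M \<gamma> L C \<rho> \<kappa> edge_gain z S]) auto
    with sum show ?thesis unfolding q d_def s_def by (simp add: mult_ac)
  qed
qed

text \<open>
  The step length \<open>h\<close> and the factor \<open>\<eta>\<close> depend on the level \<open>r\<close>, but not on the radius \<open>L\<close>.
\<close>

lemma paraboloid_growth:
  assumes r: "0 < r" "r \<le> \<theta>" "l * r < \<beta>"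
  shows "\<exists>h>0. \<exists>\<eta>>1. M * h < 1 \<and> (\<exists>L0>0. \<forall>L\<ge>L0. \<forall>c y t. 0 \<le> c \<longrightarrow> c \<le> r \<longrightarrow> 0 \<le> t \<longrightarrow>
    (AE x in lebesgue. c * paraboloid L (x - y) \<le> u t x) \<longrightarrow>
    (AE x in lebesgue. min r (\<eta> * c) * paraboloid L (x - (y + h *\<^sub>R D)) \<le> u (t + h) x))"
proof -
  define \<gamma> where "\<gamma> = \<beta> - l * r"
  have \<gamma>: "0 < \<gamma>" using r by (simp add: \<gamma>_def)
  define C where "C = 2 * norm D * (2 * M + \<gamma>) + 1"
  have C: "0 < C" using M_pos \<gamma> by (simp add: C_def add_nonneg_pos)
  \<comment> \<open>One entry for each smallness condition on \<open>h\<close> in \<open>paraboloid_step_lower_bound\<close>.\<close>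
  define h where "h = Min {1 / (2 * M), \<gamma> / (4 * M * (M + \<gamma>)), \<gamma> * \<rho> / (32 * C), \<kappa> * edge_gain / (4 * C), \<rho> / (8 * (norm D + 1))}"
  have D1: "0 < norm D + 1" by (simp add: add_nonneg_pos)
  have h0: "0 < h"
    unfolding h_def using M_pos \<gamma> C rho_pos kappa_pos edge_gain_pos D1 by (subst Min_gr_iff) auto
  have "h \<le> 1 / (2 * M)" "h \<le> \<gamma> / (4 * M * (M + \<gamma>))" "h \<le> \<gamma> * \<rho> / (32 * C)"
    "h \<le> \<kappa> * edge_gain / (4 * C)" and h5: "h \<le> \<rho> / (8 * (norm D + 1))"
    unfolding h_def by (rule Min_le; simp)+
  then have Mh: "M * h \<le> 1 / 2" and h1: "4 * M * (M + \<gamma>) * h \<le> \<gamma>" and h2: "32 * C * h \<le> \<gamma> * \<rho>"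
    and h3: "4 * C * h \<le> \<kappa> * edge_gain"
    using M_pos \<gamma> C by (simp_all add: pos_le_divide_eq mult_ac)
  have "h * norm D \<le> h * (norm D + 1)" using h0 by simp
  also have "\<dots> \<le> \<rho> / 8" using h5 D1 by (simp add: pos_le_divide_eq mult_ac)
  finally have h4: "norm (h *\<^sub>R D) \<le> \<rho> / 8" using h0 by simp
  define z where "z = 1 - M * h"
  have z: "0 < z" "z \<le> 1" using Mh h0 M_pos by (auto simp: z_def)
  define \<alpha> where "\<alpha> = z + h * z\<^sup>2 * (p - l * r)"
  define d where "d = h *\<^sub>R D"
  have lr: "l * r \<le> p"
    using mult_left_mono[OF r(2), of l] l_pos p_ge_l by linarith
  have "((\<lambda>L. \<alpha> * (norm d)\<^sup>2 / L + h * z\<^sup>2 * \<kappa> * tangent_error d L) \<longlongrightarrow> 0 + h * z\<^sup>2 * \<kappa> * 0) at_top"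
    by (intro tendsto_add tendsto_mult_left tangent_error_tendsto_0 real_tendsto_divide_at_top[OF tendsto_const] filterlim_ident)
  then have "\<forall>\<^sub>F L in at_top. \<alpha> * (norm d)\<^sup>2 / L + h * z\<^sup>2 * \<kappa> * tangent_error d L < h\<^sup>2"
    using h0 by (intro order_tendstoD(2)[where y = 0]) auto
  then obtain L1 where L1: "\<And>L. L1 \<le> L \<Longrightarrow> \<alpha> * (norm d)\<^sup>2 / L + h * z\<^sup>2 * \<kappa> * tangent_error d L < h\<^sup>2"
    by (auto simp: eventually_at_top_linorder)
  define \<eta> where "\<eta> = 1 + h * \<gamma> / 4"
  have \<eta>: "1 < \<eta>" using h0 \<gamma> by (simp add: \<eta>_def)
  have step: "AE x in lebesgue. min r (\<eta> * c) * paraboloid L (x - (y + d)) \<le> u (t + h) x"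
    if L: "max L1 \<rho> \<le> L" and c: "0 \<le> c" "c \<le> r" and t: "0 \<le> t"
      and low: "AE x in lebesgue. c * paraboloid L (x - y) \<le> u t x" for L c y t
  proof -
    have L0: "0 < L" "\<rho> \<le> L" using L rho_pos by auto
    define w where "w x = c * paraboloid L (x - y)" for x
    have w: "w \<in> Eplus E \<theta>" unfolding w_def using c r L0 by (intro scaled_paraboloid_in_Eplus) auto
    have zw: "(\<lambda>x. z * w x) \<in> Eplus E \<theta>" using w z by (intro scaled_in_Eplus) auto
    have w0: "0 \<le> w x" for x using c by (simp add: w_def paraboloid_nonneg)
    have wr: "w x \<le> r" for x
      using mult_left_le[OF paraboloid_le_1, of c L "x - y"] c by (simp add: w_def)
    have zwr: "z * w x \<le> r" "0 \<le> z * w x" for x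
      using mult_left_le_one_le[of "w x" z] w0[of x] wr[of x] z by auto
    have conv: "conv a (\<lambda>x. z * w x) x = z * c * conv a (paraboloid L) (x - y)" for x
      using conv_scaled_translate[OF a_measurable paraboloid_lebesgue_measurable, of "z * c" L y x]
      by (simp add: w_def mult.assoc)
    show ?thesis
    proof (rule sol_step[OF t h0 _ w])
      show "M * h < 1" using Mh by simp
      show "AE x in lebesgue. w x \<le> u t x" using low by (simp add: w_def)
      show "(\<lambda>x. min r (\<eta> * c) * paraboloid L (x - (y + d))) \<in> borel_measurable lebesgue"
        using paraboloid_lebesgue_measurable[of L] by measurable
      have mr: "0 \<le> min r (\<eta> * c)" using r c \<eta> by simp
      show "\<bar>min r (\<eta> * c) * paraboloid L (x - (y + d))\<bar> \<le> r" for x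
        using mult_left_le[OF paraboloid_le_1 mr, of L "x - (y + d)"] mr
        by (simp add: abs_mult abs_of_nonneg paraboloid_nonneg)
      show "AE x in lebesgue. min r (\<eta> * c) * paraboloid L (x - (y + d))
        \<le> (1 - M * h) * w x + h * (1 - M * h) * F (\<lambda>x. (1 - M * h) * w x) x"
        unfolding z_def[symmetric] using F_ge_linear[OF zw zwr(2,1)]
      proof eventually_elim
        case (elim x)
        define x' where "x' = x - (y + d)"
        have xy: "x - y = x' + d" by (simp add: x'_def)
        have e1: "conv a (\<lambda>x. z * w x) x = z * c * conv a (paraboloid L) (x' + d)" using conv[of x] xy by simp
        have e2: "w x = c * paraboloid L (x' + d)" by (simp add: w_def xy)
        have "min r (\<eta> * c) * paraboloid L x' \<le> \<eta> * c * paraboloid L x'"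
          by (intro mult_right_mono paraboloid_nonneg) auto
        also have "\<dots> = c * (\<eta> * paraboloid L x')" by simp
        also have "\<dots> \<le> c * (\<alpha> * paraboloid L (x' + d) + h * z\<^sup>2 * (\<kappa> * conv a (paraboloid L) (x' + d)))"
          using paraboloid_step_lower_bound[OF h0 Mh \<gamma> \<gamma>_def lr C_def h1 h2 h3 h4 z_def \<alpha>_def L0, of x']
            L1[of L] L c
          unfolding \<eta>_def d_def by (intro mult_left_mono) auto
        also have "\<dots> = z * w x + h * z * (\<kappa> * conv a (\<lambda>x. z * w x) x + (p - l * r) * (z * w x))"
          unfolding e1 e2 \<alpha>_def by (simp add: algebra_simps power2_eq_square)
        also have "\<dots> \<le> z * w x + h * z * F (\<lambda>x. z * w x) x"
          using elim h0 z by (intro add_left_mono mult_left_mono) auto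
        finally show ?case by (simp add: x'_def)
      qed
    qed
  qed
  show ?thesis
  proof (intro exI conjI)
    show "0 < h" "1 < \<eta>" "M * h < 1" using h0 \<eta> Mh by auto
    show "0 < max L1 \<rho>" using rho_pos by simp
    show "\<forall>L\<ge>max L1 \<rho>. \<forall>c y t. 0 \<le> c \<longrightarrow> c \<le> r \<longrightarrow> 0 \<le> t \<longrightarrow>
      (AE x in lebesgue. c * paraboloid L (x - y) \<le> u t x) \<longrightarrow>
      (AE x in lebesgue. min r (\<eta> * c) * paraboloid L (x - (y + h *\<^sub>R D)) \<le> u (t + h) x)"
      using step unfolding d_def by blast
  qed
qed

text \<open>
  In the frame moving with the drift, the solution is eventually at least \<open>r\<close> on every ball.
\<close>

definition persists :: "real \<Rightarrow> bool" where
  "persists r \<longleftrightarrow> (\<forall>R. \<exists>T\<ge>0. \<forall>t\<ge>T. AE x in lebesgue. norm x \<le> R \<longrightarrow> r \<le> u t (x + t *\<^sub>R D))"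

lemma persists_some: "\<exists>r>0. r < \<theta> \<and> persists r"
proof -
  define r where "r = min \<theta> (\<beta> / (2 * l))"
  have r: "0 < r" "r \<le> \<theta>" "l * r < \<beta>"
  proof -
    show "0 < r" "r \<le> \<theta>" using theta_pos beta_pos l_pos by (auto simp: r_def)
    have "l * r \<le> l * (\<beta> / (2 * l))" using l_pos by (intro mult_left_mono) (auto simp: r_def)
    then show "l * r < \<beta>" using l_pos beta_pos by simp
  qed
  from paraboloid_growth[OF r] obtain h \<eta> L0 where h: "0 < h" "M * h < 1" and \<eta>: "1 < \<eta>" and L0: "0 < L0"
    and step: "\<And>L c y t. L0 \<le> L \<Longrightarrow> 0 \<le> c \<Longrightarrow> c \<le> r \<Longrightarrow> 0 \<le> t \<Longrightarrow>
      AE x in lebesgue. c * paraboloid L (x - y) \<le> u t x \<Longrightarrow>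
      AE x in lebesgue. min r (\<eta> * c) * paraboloid L (x - (y + h *\<^sub>R D)) \<le> u (t + h) x"
    by blast
  have "persists (r / 2)"
    unfolding persists_def
  proof
    fix R :: real
    define L where "L = max L0 (2 * R)"
    have L: "L0 \<le> L" "0 < L" "2 * R \<le> L" using L0 by (auto simp: L_def)
    obtain c0 where c0: "0 < c0" "\<forall>t\<in>{1..1 + h}. AE x in lebesgue. norm x \<le> L + (1 + h) * norm D \<longrightarrow> c0 \<le> u t x"
      using positive_on_ball[of 1 h "L + (1 + h) * norm D"] h by auto
    define c where "c = min r c0"
    have c: "0 < c" "c \<le> r" using r c0 by (auto simp: c_def)
    \<comment> \<open>The centre at time \<open>t + n h\<close> is \<open>(t + n h) D\<close>, including the time before the iteration starts;
      the starting bound holds on a ball large enough to contain the shifted paraboloid.\<close>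
    have iter: "AE x in lebesgue. min r (\<eta> ^ n * c) * paraboloid L (x - (t + n * h) *\<^sub>R D) \<le> u (t + n * h) x"
      if t: "1 \<le> t" "t \<le> 1 + h" for n :: nat and t
    proof (induction n)
      case 0
      have t0: "0 \<le> t" using t by simp
      have "AE x in lebesgue. norm x \<le> L + (1 + h) * norm D \<longrightarrow> c0 \<le> u t x" using c0 t by auto
      then have "AE x in lebesgue. c * paraboloid L (x - t *\<^sub>R D) \<le> u t x"
        using sol_AE_bounds[OF t0]
      proof eventually_elim
        case (elim x)
        show ?case
        proof (cases "norm (x - t *\<^sub>R D) \<le> L")
          case True
          have "norm x \<le> norm (x - t *\<^sub>R D) + t * norm D"
            using norm_triangle_ineq[of "x - t *\<^sub>R D" "t *\<^sub>R D"] t0 by simp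
          also have "\<dots> \<le> L + (1 + h) * norm D" using True t by (intro add_mono mult_right_mono) auto
          finally have "c \<le> u t x" using elim by (simp add: c_def)
          moreover have "c * paraboloid L (x - t *\<^sub>R D) \<le> c" using c by (intro mult_left_le paraboloid_le_1) auto
          ultimately show ?thesis by simp
        qed (use elim L in \<open>simp add: paraboloid_eq_0\<close>)
      qed
      then show ?case using c by simp
    next
      case (Suc n)
      have nn: "0 \<le> t + n * h" using t h by simp
      have cn: "0 \<le> min r (\<eta> ^ n * c)" "min r (\<eta> ^ n * c) \<le> r" using r c \<eta> by auto
      have 1: "(t + n * h) *\<^sub>R D + h *\<^sub>R D = (t + Suc n * h) *\<^sub>R D" by (simp add: algebra_simps)
      have 2: "t + n * h + h = t + Suc n * h" by (simp add: algebra_simps)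
      have le: "min r (\<eta> ^ Suc n * c) \<le> min r (\<eta> * min r (\<eta> ^ n * c))"
      proof -
        have "r \<le> \<eta> * r" using \<eta> r by simp
        then show ?thesis using \<eta> by (auto simp: min_def mult_ac)
      qed
      show ?case
        using step[OF L(1) cn nn Suc]
        unfolding 1 2
      proof eventually_elim
        case (elim x)
        have "min r (\<eta> ^ Suc n * c) * paraboloid L (x - (t + Suc n * h) *\<^sub>R D)
          \<le> min r (\<eta> * min r (\<eta> ^ n * c)) * paraboloid L (x - (t + Suc n * h) *\<^sub>R D)"
          using le by (rule mult_right_mono) (rule paraboloid_nonneg)
        then show ?case using elim by simp
      qed
    qed
    obtain N where N: "r / c < \<eta> ^ N" using real_arch_pow[OF \<eta>] by blast
    show "\<exists>T\<ge>0. \<forall>t\<ge>T. AE x in lebesgue. norm x \<le> R \<longrightarrow> r / 2 \<le> u t (x + t *\<^sub>R D)"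
    proof (intro exI conjI allI impI)
      show "0 \<le> 1 + (N + 1) * h" using h by simp
      fix t assume t: "1 + (N + 1) * h \<le> t"
      \<comment> \<open>Write \<open>t\<close> as a starting time in \<open>[1, 1 + h]\<close> plus \<open>n\<close> steps of length \<open>h\<close>.\<close>
      define n where "n = nat \<lfloor>(t - 1) / h\<rfloor>"
      have "(real N + 1) * h \<le> t - 1" using t by (simp add: algebra_simps)
      then have "real N + 1 \<le> (t - 1) / h" using h by (simp add: pos_le_divide_eq)
      then have f: "0 \<le> (t - 1) / h" "N \<le> n" unfolding n_def by linarith+
      have nf: "real n = of_int \<lfloor>(t - 1) / h\<rfloor>" using f(1) by (simp add: n_def)
      have "real n \<le> (t - 1) / h" "(t - 1) / h < real n + 1" unfolding nf by linarith+
      then have n: "n * h \<le> t - 1" "t - 1 \<le> n * h + h"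
        using h by (simp_all add: pos_le_divide_eq pos_divide_less_eq algebra_simps)
      have "r \<le> \<eta> ^ N * c" using N c by (simp add: pos_divide_less_eq)
      also have "\<dots> \<le> \<eta> ^ n * c" using \<eta> f(2) c by (intro mult_right_mono power_increasing) auto
      finally have m: "min r (\<eta> ^ n * c) = r" by simp
      have "AE x in lebesgue. r * paraboloid L (x - t *\<^sub>R D) \<le> u t x"
        using iter[of "t - n * h" n] n m by simp
      from AE_lebesgue_shift(3)[OF this, of "t *\<^sub>R D"]
      show "AE x in lebesgue. norm x \<le> R \<longrightarrow> r / 2 \<le> u t (x + t *\<^sub>R D)"
      proof eventually_elim
        case (elim x)
        show ?case
        proof
          assume "norm x \<le> R"
          then have "norm x \<le> L / 2" using L by simp
          then have "3 / 4 \<le> paraboloid L x" using L by (intro paraboloid_ge_on_half_ball)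
          then have "1 / 2 \<le> paraboloid L x" by simp
          then have "r * (1 / 2) \<le> r * paraboloid L x" using r by (intro mult_left_mono) auto
          then show "r / 2 \<le> u t (x + t *\<^sub>R D)" using elim by simp
        qed
      qed
    qed
  qed
  then show ?thesis using r by (intro exI[of _ "r / 2"]) auto
qed

section \<open>Convergence to the upper equilibrium\<close>

lemma persists_mono:
  assumes "persists r" "s \<le> r" shows "persists s"
  unfolding persists_def
proof
  fix R
  obtain T where T: "0 \<le> T" "\<And>t. T \<le> t \<Longrightarrow> AE x in lebesgue. norm x \<le> R \<longrightarrow> r \<le> u t (x + t *\<^sub>R D)"
    using assms(1) unfolding persists_def by blast
  have "AE x in lebesgue. norm x \<le> R \<longrightarrow> s \<le> u t (x + t *\<^sub>R D)" if "T \<le> t" for t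
    using T(2)[OF that] by eventually_elim (use assms(2) in auto)
  then show "\<exists>T\<ge>0. \<forall>t\<ge>T. AE x in lebesgue. norm x \<le> R \<longrightarrow> s \<le> u t (x + t *\<^sub>R D)"
    using T(1) by blast
qed

lemma G_const_AE_const:
  assumes "0 \<le> r" "r \<le> \<theta>"
  obtains g where "AE x in lebesgue. G (\<lambda>_. r) x = g" "0 \<le> g"
proof -
  have r: "(\<lambda>_. r) \<in> Eplus E \<theta>" using assms by (intro const_in_Eplus)
  have "\<exists>c. AE x in lebesgue. G (\<lambda>_. r) x = c"
  proof (rule AE_const_if_translation_invariant)
    show "G (\<lambda>_. r) \<in> borel_measurable lebesgue"
      by (intro space_of_measurable[of _ E] G_space EplusD(1)[OF r])
    fix y :: 'a
    show "AE x in lebesgue. G (\<lambda>_. r) (x - y) = G (\<lambda>_. r) x"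
      using forall_in_imp_AE[OF G_translate[OF r, of y, unfolded eq_in_def]] by (simp add: translate_def)
  qed
  then obtain g where g: "AE x in lebesgue. G (\<lambda>_. r) x = g" by blast
  have "AE x in (lebesgue :: 'a measure). 0 \<le> g"
    using g forall_in_imp_AE[OF G_ge[OF r, unfolded le_in_def]] forall_in_imp_AE[OF G_zero[unfolded eq_in_def]]
    by eventually_elim simp
  then have "0 \<le> g" by (rule AE_lebesgue_const)
  with g that show thesis by blast
qed

lemma conv_paraboloid_tendsto_1:
  assumes "\<epsilon> > 0"
  shows "\<forall>\<^sub>F n in sequentially. \<forall>x. norm x \<le> R \<longrightarrow> 1 - \<epsilon> \<le> conv a (paraboloid (real (Suc n))) x"
proof -
  define R' where "R' = max R 0"
  define f where "f n y = max 0 (1 - (R' + norm y)\<^sup>2 / (real (Suc n))\<^sup>2)" for n :: nat and y :: 'a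
  have f_meas: "f n \<in> borel_measurable lebesgue" for n
    unfolding f_def by (rule measurable_completion) measurable
  have f01: "0 \<le> f n y" "f n y \<le> 1" for n y by (auto simp: f_def)
  have "(\<lambda>n. \<integral>y. a y * f n y \<partial>lebesgue) \<longlonglongrightarrow> (\<integral>y. a y * 1 \<partial>lebesgue)"
  proof (rule integral_dominated_convergence[where w = "\<lambda>y. \<bar>a y\<bar>"])
    show "(\<lambda>y. a y * f n y) \<in> borel_measurable lebesgue" for n using f_meas[of n] by measurable
    show "AE y in lebesgue. norm (a y * f n y) \<le> \<bar>a y\<bar>" for n
      using f01 by (auto simp: abs_mult abs_of_nonneg intro!: mult_left_le AE_I2)
    have "(\<lambda>n. a y * f n y) \<longlonglongrightarrow> a y * 1" for y
    proof (rule tendsto_mult_left)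
      have "(\<lambda>n. max 0 (1 - (R' + norm y)\<^sup>2 * (1 / real (Suc n))\<^sup>2)) \<longlonglongrightarrow> max 0 (1 - (R' + norm y)\<^sup>2 * 0\<^sup>2)"
        by (intro tendsto_intros LIMSEQ_Suc[OF lim_1_over_n])
      then show "(\<lambda>n. f n y) \<longlonglongrightarrow> 1" by (simp add: f_def power_divide)
    qed
    then show "AE y in lebesgue. (\<lambda>n. a y * f n y) \<longlonglongrightarrow> a y * 1" by simp
  qed (use a_int in \<open>simp_all\<close>)
  then have "(\<lambda>n. \<integral>y. a y * f n y \<partial>lebesgue) \<longlonglongrightarrow> 1" using a_mass by simp
  then have "\<forall>\<^sub>F n in sequentially. 1 - \<epsilon> < (\<integral>y. a y * f n y \<partial>lebesgue)"
    using assms by (intro order_tendstoD(1)[where y = 1]) auto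
  then show ?thesis
  proof eventually_elim
    case (elim n)
    show ?case
    proof (intro allI impI)
      fix x :: 'a assume x: "norm x \<le> R"
      have "(\<integral>y. a y * f n y \<partial>lebesgue) \<le> (\<integral>y. a y * paraboloid (real (Suc n)) (x - y) \<partial>lebesgue)"
      proof (rule integral_mono_AE)
        show "integrable lebesgue (\<lambda>y. a y * f n y)"
          using f01 by (intro integrable_mult_bounded[OF a_int f_meas, of _ 1]) (simp add: abs_of_nonneg)
        show "integrable lebesgue (\<lambda>y. a y * paraboloid (real (Suc n)) (x - y))"
        proof (rule integrable_mult_bounded[OF a_int])
          show "(\<lambda>y. paraboloid (real (Suc n)) (x - y)) \<in> borel_measurable lebesgue"
            using paraboloid_lebesgue_measurable[of "real (Suc n)"] by measurable
          show "\<bar>paraboloid (real (Suc n)) (x - y)\<bar> \<le> 1" for y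
            by (simp add: abs_of_nonneg paraboloid_nonneg paraboloid_le_1)
        qed
        show "AE y in lebesgue. a y * f n y \<le> a y * paraboloid (real (Suc n)) (x - y)"
          using a_nonneg
        proof eventually_elim
          case (elim y)
          have "norm (x - y) \<le> R' + norm y" using norm_triangle_ineq4[of x y] x by (simp add: R'_def)
          then have "(norm (x - y))\<^sup>2 \<le> (R' + norm y)\<^sup>2" by (intro power_mono) auto
          then have "(norm (x - y))\<^sup>2 / (real (Suc n))\<^sup>2 \<le> (R' + norm y)\<^sup>2 / (real (Suc n))\<^sup>2"
            by (rule divide_right_mono) simp
          then have "f n y \<le> paraboloid (real (Suc n)) (x - y)"
            unfolding f_def paraboloid_def by (intro max.mono) auto
          then show ?case using elim by (rule mult_left_mono)
        qed
      qed
      then show "1 - \<epsilon> \<le> conv a (paraboloid (real (Suc n))) x"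
        unfolding conv_commute[OF a_measurable paraboloid_lebesgue_measurable] using elim by linarith
    qed
  qed
qed

text \<open>
  A constant \<open>r\<close> is mapped by one step to \<open>r (z + h z\<^sup>2 (\<kappa> + p - g))\<close>, where \<open>g\<close> is the value of \<open>G (z r)\<close>.
  Every smaller level persists if \<open>r\<close> does, because wide paraboloids of height \<open>r\<close> behave like the constant \<open>r\<close> on a
  fixed ball.
\<close>

lemma persists_step:
  assumes r: "0 < r" "r \<le> \<theta>" and h: "0 < h" "M * h < 1" and z: "z = 1 - M * h"
    and g: "AE x in lebesgue. G (\<lambda>_. z * r) x = g" "0 \<le> g"
    and r': "0 \<le> r'" "r' < r * (z + h * z\<^sup>2 * (\<kappa> + p - g))"
    and pr: "persists r"
  shows "persists r'"
  unfolding persists_def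
proof
  fix R :: real
  define R2 where "R2 = R + h * norm D"
  have z01: "0 < z" "z \<le> 1" using h M_pos by (auto simp: z)
  define Cst where "Cst = z * r + h * z\<^sup>2 * r * (\<kappa> + 1 + p)"
  have Cst: "0 < Cst" using z01 r h kappa_pos p_nonneg by (simp add: Cst_def add_pos_nonneg)
  \<comment> \<open>An error of relative size \<open>\<epsilon>\<close> in \<open>w\<close> and \<open>a*w\<close>, and of size \<open>\<epsilon>\<close> in \<open>G (z w)\<close>, lowers the
    new level by at most \<open>\<epsilon> Cst\<close>.\<close>
  define \<epsilon> where "\<epsilon> = min (1 / 2) ((r * (z + h * z\<^sup>2 * (\<kappa> + p - g)) - r') / Cst)"
  have \<epsilon>: "0 < \<epsilon>" "\<epsilon> < 1" using r' Cst by (auto simp: \<epsilon>_def)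
  have r'_le: "r' \<le> z * (r * (1 - \<epsilon>)) + h * z * (\<kappa> * (z * (r * (1 - \<epsilon>))) - z * r * (g + \<epsilon>) + p * (z * (r * (1 - \<epsilon>))))"
  proof -
    have "\<epsilon> * Cst \<le> r * (z + h * z\<^sup>2 * (\<kappa> + p - g)) - r'"
      using Cst by (simp add: \<epsilon>_def pos_le_divide_eq[symmetric])
    then show ?thesis by (simp add: Cst_def algebra_simps power2_eq_square)
  qed
  define v where "v n x = z * (r * paraboloid (real (Suc n)) x)" for n :: nat and x :: 'a
  have v_in: "v n \<in> Eplus E \<theta>" for n
  proof -
    have "(\<lambda>x. r * paraboloid (real (Suc n)) (x - 0)) \<in> Eplus E \<theta>"
      using r by (intro scaled_paraboloid_in_Eplus) auto
    from scaled_in_Eplus[OF this, of z] show ?thesis unfolding v_def[abs_def] using z01 by simp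
  qed
  have "0 \<le> z * r" "z * r \<le> \<theta>"
    using z01 r mult_left_le_one_le[of r z] by (simp, linarith)
  then have zr: "(\<lambda>_. z * r) \<in> Eplus E \<theta>" by (rule const_in_Eplus)
  have "loc_unif_conv E v (\<lambda>_. z * r)"
    unfolding loc_unif_conv_def
  proof (intro allI impI)
    fix K :: "'a set" and e :: real assume "compact K" "0 < e"
    obtain B where B: "\<And>x. x \<in> K \<Longrightarrow> norm x \<le> B"
      using compact_imp_bounded[OF \<open>compact K\<close>] by (auto simp: bounded_iff)
    have "0 < e / (z * r)" using \<open>0 < e\<close> z01 r by simp
    from paraboloid_tendsto_1[where 'a = 'a, OF this, of B]
    show "\<forall>\<^sub>F n in sequentially. forall_in E (\<lambda>x. x \<in> K \<longrightarrow> \<bar>v n x - z * r\<bar> < e)"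
    proof eventually_elim
      case (elim n)
      have "\<bar>v n x - z * r\<bar> < e" if "x \<in> K" for x
      proof -
        have "1 - e / (z * r) < paraboloid (real (Suc n)) x" using elim B[OF that] by blast
        then have "z * r * (1 - paraboloid (real (Suc n)) x) < e"
          using z01 r by (simp add: pos_less_divide_eq mult.commute field_simps)
        moreover have "z * r - v n x = z * r * (1 - paraboloid (real (Suc n)) x)" by (simp add: v_def algebra_simps)
        moreover have "0 \<le> z * r * (1 - paraboloid (real (Suc n)) x)" using z01 r by (simp add: paraboloid_le_1)
        ultimately show ?thesis by linarith
      qed
      then show ?case by (intro forall_in_if_all) blast
    qed
  qed
  from G_loc_unif[OF v_in zr this, unfolded loc_unif_conv_def, rule_format, OF compact_cball \<epsilon>(1)]
  have "\<forall>\<^sub>F n in sequentially. forall_in E (\<lambda>x. x \<in> cball 0 R2 \<longrightarrow> \<bar>G (v n) x - G (\<lambda>_. z * r) x\<bar> < \<epsilon>)"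
    .
  with conv_paraboloid_tendsto_1[OF \<epsilon>(1), of R2] paraboloid_tendsto_1[where 'a = 'a, OF \<epsilon>(1), of R2]
  have "\<forall>\<^sub>F n in sequentially. forall_in E (\<lambda>x. x \<in> cball 0 R2 \<longrightarrow> \<bar>G (v n) x - G (\<lambda>_. z * r) x\<bar> < \<epsilon>)
    \<and> (\<forall>x. norm x \<le> R2 \<longrightarrow> 1 - \<epsilon> \<le> conv a (paraboloid (real (Suc n))) x)
    \<and> (\<forall>x::'a. norm x \<le> R2 \<longrightarrow> 1 - \<epsilon> < paraboloid (real (Suc n)) x)"
    by eventually_elim (intro conjI)
  from eventually_happens'[OF sequentially_bot this] obtain n where n: "forall_in E (\<lambda>x. x \<in> cball 0 R2 \<longrightarrow> \<bar>G (v n) x - G (\<lambda>_. z * r) x\<bar> < \<epsilon>)"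
    "\<And>x. norm x \<le> R2 \<Longrightarrow> 1 - \<epsilon> \<le> conv a (paraboloid (real (Suc n))) x"
    "\<And>x::'a. norm x \<le> R2 \<Longrightarrow> 1 - \<epsilon> < paraboloid (real (Suc n)) x"
    by blast
  define L where "L = real (Suc n)"
  have L: "0 < L" by (simp add: L_def)
  have Gv: "AE x in lebesgue. norm x \<le> R2 \<longrightarrow> G (v n) x \<le> g + \<epsilon>"
    using forall_in_imp_AE[OF n(1)] g(1) by eventually_elim auto
  obtain T where T: "0 \<le> T" "\<And>t. T \<le> t \<Longrightarrow> AE x in lebesgue. norm x \<le> L \<longrightarrow> r \<le> u t (x + t *\<^sub>R D)"
    using pr unfolding persists_def by blast
  have step: "AE x in lebesgue. norm (x - t *\<^sub>R D) \<le> R2 \<longrightarrow> r' \<le> u (t + h) x" if t: "T \<le> t" for t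
  proof -
    define y where "y = t *\<^sub>R D"
    have t0: "0 \<le> t" using t T by simp
    define w where "w x = r * paraboloid L (x - y)" for x
    have w: "w \<in> Eplus E \<theta>" unfolding w_def using r L by (intro scaled_paraboloid_in_Eplus) auto
    have w0: "0 \<le> w x" for x using r by (simp add: w_def paraboloid_nonneg)
    have wr: "w x \<le> r" for x using r mult_left_le[OF paraboloid_le_1, of r L "x - y"] by (simp add: w_def)
    have zw: "(\<lambda>x. z * w x) \<in> Eplus E \<theta>" using w z01 by (intro scaled_in_Eplus) auto
    have zw_eq: "(\<lambda>x. z * w x) = translate y (v n)" by (simp add: translate_def v_def w_def L_def)
    have conv: "conv a (\<lambda>x. z * w x) x = z * r * conv a (paraboloid L) (x - y)" for x
      using conv_scaled_translate[OF a_measurable paraboloid_lebesgue_measurable, of "z * r" L y x]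
      by (simp add: w_def mult.assoc)
    have low: "AE x in lebesgue. w x \<le> u t x"
      using AE_lebesgue_shift(2)[OF T(2)[OF t], of y] sol_AE_bounds[OF t0]
    proof eventually_elim
      case (elim x)
      show ?case
      proof (cases "norm (x - y) \<le> L")
        case True
        then show ?thesis using elim wr[of x] by (simp add: y_def)
      qed (use elim L in \<open>simp add: w_def paraboloid_eq_0\<close>)
    qed
    have "AE x in lebesgue. r' * indicator (cball y R2) x \<le> u (t + h) x"
    proof (rule sol_step[OF t0 h w low])
      have "(\<lambda>x. r' * indicator (cball y R2) x) \<in> borel_measurable (lborel :: 'a measure)"
        by (intro borel_measurable_times borel_measurable_const borel_measurable_indicator) simp
      then show "(\<lambda>x. r' * indicator (cball y R2) x) \<in> borel_measurable lebesgue"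
        by (rule measurable_completion)
      show "\<bar>r' * indicator (cball y R2) x\<bar> \<le> r'" for x using r' by (simp add: indicator_def)
      have "AE x in lebesgue. G (\<lambda>x. z * w x) x = translate y (G (v n)) x"
        unfolding zw_eq using forall_in_imp_AE[OF G_translate[OF v_in, of y n, unfolded eq_in_def]]
        by eventually_elim simp
      then show "AE x in lebesgue. r' * indicator (cball y R2) x
        \<le> (1 - M * h) * w x + h * (1 - M * h) * F (\<lambda>x. (1 - M * h) * w x) x"
        unfolding z[symmetric] using AE_lebesgue_shift(2)[OF Gv, of y] F_nonneg[OF zw]
      proof eventually_elim
        case (elim x)
        show ?case
        proof (cases "x \<in> cball y R2")
          case True
          then have x: "norm (x - y) \<le> R2" by (simp add: dist_norm norm_minus_commute)
          have w1: "r * (1 - \<epsilon>) \<le> w x"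
            unfolding w_def L_def using n(3)[OF x] r by (intro mult_left_mono) auto
          have c1: "z * (r * (1 - \<epsilon>)) \<le> conv a (\<lambda>x. z * w x) x"
            unfolding conv L_def mult.assoc using n(2)[OF x] r z01 by (intro mult_left_mono) auto
          have "G (\<lambda>x. z * w x) x \<le> g + \<epsilon>" using elim x by (simp add: translate_def)
          then have "z * w x * G (\<lambda>x. z * w x) x \<le> z * w x * (g + \<epsilon>)"
            using z01 w0 by (intro mult_left_mono) auto
          also have "\<dots> \<le> z * r * (g + \<epsilon>)" using z01 wr \<epsilon> g by (intro mult_right_mono mult_left_mono) auto
          finally have G1: "z * w x * G (\<lambda>x. z * w x) x \<le> z * r * (g + \<epsilon>)" .
          have "\<kappa> * (z * (r * (1 - \<epsilon>))) \<le> \<kappa> * conv a (\<lambda>x. z * w x) x" using c1 kappa_pos by simp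
          moreover have zw1: "z * (r * (1 - \<epsilon>)) \<le> z * w x" using w1 z01 by simp
          then have "p * (z * (r * (1 - \<epsilon>))) \<le> p * (z * w x)" using p_nonneg by (rule mult_left_mono)
          ultimately have "\<kappa> * (z * (r * (1 - \<epsilon>))) - z * r * (g + \<epsilon>) + p * (z * (r * (1 - \<epsilon>))) \<le> F (\<lambda>x. z * w x) x"
            unfolding F_def using G1 by linarith
          then have "h * z * (\<kappa> * (z * (r * (1 - \<epsilon>))) - z * r * (g + \<epsilon>) + p * (z * (r * (1 - \<epsilon>)))) \<le> h * z * F (\<lambda>x. z * w x) x"
            using h z01 by (intro mult_left_mono) auto
          then show ?thesis using True r'_le zw1 by simp
        next
          case False
          then show ?thesis using elim w0[of x] h z01 by simp
        qed
      qed
    qed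
    then show ?thesis
      by eventually_elim (auto simp: y_def dist_norm norm_minus_commute indicator_def split: if_splits)
  qed
  show "\<exists>T\<ge>0. \<forall>t\<ge>T. AE x in lebesgue. norm x \<le> R \<longrightarrow> r' \<le> u t (x + t *\<^sub>R D)"
  proof (intro exI[of _ "T + h"] conjI allI impI)
    fix t assume "T + h \<le> t"
    then have "T \<le> t - h" by simp
    from AE_lebesgue_shift(3)[OF step[OF this], of "t *\<^sub>R D"]
    show "AE x in lebesgue. norm x \<le> R \<longrightarrow> r' \<le> u t (x + t *\<^sub>R D)"
    proof eventually_elim
      case (elim x)
      have e: "x + t *\<^sub>R D - (t - h) *\<^sub>R D = x + h *\<^sub>R D" by (simp add: algebra_simps)
      have "norm (x + h *\<^sub>R D) \<le> norm x + h * norm D"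
        using norm_triangle_ineq[of x "h *\<^sub>R D"] h by simp
      then show ?case using elim unfolding e by (simp add: R2_def)
    qed
  qed (use T h in simp)
qed

lemma persists_below_theta:
  assumes "r < \<theta>"
  shows "persists r"
proof -
  define S where "S = {r. 0 < r \<and> r < \<theta> \<and> persists r}"
  have ne: "S \<noteq> {}" using persists_some by (auto simp: S_def)
  have bdd: "bdd_above S" by (auto simp: S_def bdd_above_def intro: less_imp_le)
  define s where "s = Sup S"
  have s0: "0 < s"
    using persists_some cSup_upper[OF _ bdd] unfolding s_def S_def by (smt (verit, best) mem_Collect_eq)
  have "s \<le> \<theta>" unfolding s_def using ne by (intro cSup_least) (auto simp: S_def)
  have "\<not> s < \<theta>"
  proof
    assume s1: "s < \<theta>"
    obtain g where g: "AE x in lebesgue. G (\<lambda>_. s) x = g" using G_const_AE_const[of s] s0 s1 by auto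
    have "AE x in (lebesgue :: 'a measure). g < \<beta>"
      using g forall_in_imp_AE[OF G_const_less[OF s0 s1]] by eventually_elim simp
    then have "g < \<beta>" by (rule AE_lebesgue_const)
    define \<gamma> where "\<gamma> = (\<beta> - g) / 2"
    have \<gamma>: "0 < \<gamma>" using \<open>g < \<beta>\<close> by (simp add: \<gamma>_def)
    \<comment> \<open>By the last entry, \<open>z r\<close> is so close to \<open>s\<close>, for levels \<open>r\<close> close to \<open>s\<close>, that \<open>G (z r) \<le> \<beta> - \<gamma>\<close>.\<close>
    define h where "h = Min {1 / (2 * M), \<gamma> / (4 * M * (M + \<gamma>)), \<gamma> / (2 * l * M * s)}"
    have h0: "0 < h" unfolding h_def using M_pos \<gamma> l_pos s0 by (subst Min_gr_iff) auto
    have "h \<le> 1 / (2 * M)" "h \<le> \<gamma> / (4 * M * (M + \<gamma>))" "h \<le> \<gamma> / (2 * l * M * s)"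
      unfolding h_def by (rule Min_le; simp)+
    then have Mh: "M * h \<le> 1 / 2" and h1: "4 * M * (M + \<gamma>) * h \<le> \<gamma>" and h2: "l * (M * h * s) \<le> \<gamma> / 2"
      using M_pos \<gamma> l_pos s0 by (simp_all add: pos_le_divide_eq mult_ac)
    define z where "z = 1 - M * h"
    have z: "0 < z" "z \<le> 1" using Mh M_pos h0 by (auto simp: z_def)
    define k where "k = 1 + h * \<gamma> / 4"
    have k: "1 < k" using h0 \<gamma> by (simp add: k_def)
    have "s / k < s" using k s0 by (simp add: pos_divide_less_eq)
    moreover have "s - \<gamma> / (2 * l) < s" using \<gamma> l_pos by simp
    ultimately have "max (s - \<gamma> / (2 * l)) (s / k) < Sup S" unfolding s_def[symmetric] by simp
    then obtain r where "r \<in> S" "max (s - \<gamma> / (2 * l)) (s / k) < r"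
      using less_cSup_iff[OF ne bdd] by blast
    then have r: "r \<in> S" "s - \<gamma> / (2 * l) < r" "s / k < r" by simp_all
    have r0: "0 < r" "r < \<theta>" "persists r" using r by (auto simp: S_def)
    have "r \<le> s" using cSup_upper[OF r(1) bdd] by (simp add: s_def)
    have zr: "0 \<le> z * r" "z * r \<le> r" using z r0 mult_left_le_one_le[of r z] by auto
    then have zr_le: "z * r \<le> \<theta>" using r0 by linarith
    obtain g' where g': "AE x in lebesgue. G (\<lambda>_. z * r) x = g'" "0 \<le> g'"
      using G_const_AE_const[OF zr(1) zr_le] by blast
    have "g' \<le> \<beta> - \<gamma>"
    proof -
      have i: "(\<lambda>_. z * r) \<in> Eplus E \<theta>" "(\<lambda>_. s) \<in> Eplus E \<theta>"
        using zr(1) zr_le s0 s1 by (auto intro: const_in_Eplus)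
      have "s - z * r = (s - r) + M * h * r" by (simp add: z_def algebra_simps)
      also have "\<dots> \<le> \<gamma> / (2 * l) + M * h * s"
        using r \<open>r \<le> s\<close> M_pos h0 by (intro add_mono mult_left_mono) auto
      finally have "l * (s - z * r) \<le> l * (\<gamma> / (2 * l) + M * h * s)" using l_pos by (intro mult_left_mono) auto
      also have "\<dots> \<le> \<gamma>" using h2 l_pos by (simp add: algebra_simps)
      finally have 1: "l * (s - z * r) \<le> \<gamma>" .
      have "norm_in E (\<lambda>x::'a. z * r - s) \<le> s - z * r"
        using zr \<open>r \<le> s\<close> by (intro norm_in_le) auto
      then have "norm_in E (\<lambda>x. G (\<lambda>_. z * r) x - G (\<lambda>_. s) x) \<le> l * (s - z * r)"
        using G_lipschitz[OF i] l_pos by (smt (verit, best) mult_left_mono)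
      moreover have "AE x in lebesgue. \<bar>G (\<lambda>_. z * r) x - G (\<lambda>_. s) x\<bar> \<le> norm_in E (\<lambda>x. G (\<lambda>_. z * r) x - G (\<lambda>_. s) x)"
        by (intro AE_le_norm_in space_of_diff G_space EplusD(1)[OF i(1)] EplusD(1)[OF i(2)])
      then have "AE x in (lebesgue :: 'a measure). \<bar>g' - g\<bar> \<le> norm_in E (\<lambda>x. G (\<lambda>_. z * r) x - G (\<lambda>_. s) x)"
        using g g'(1) by eventually_elim simp
      then have "\<bar>g' - g\<bar> \<le> norm_in E (\<lambda>x. G (\<lambda>_. z * r) x - G (\<lambda>_. s) x)"
        by (rule AE_lebesgue_const)
      ultimately have "\<bar>g' - g\<bar> \<le> \<gamma>" using 1 by simp
      moreover have "\<beta> = g + 2 * \<gamma>" by (simp add: \<gamma>_def field_simps)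
      ultimately show ?thesis by linarith
    qed
    define r' where "r' = r * k"
    have "s < r'" using r(3) k by (simp add: r'_def pos_divide_less_eq)
    have "1 + h * \<gamma> / 2 \<le> z + h * z\<^sup>2 * (M + \<gamma>)"
      by (rule amplification[OF h0 M_pos \<gamma> h1 z_def])
    also have "\<dots> \<le> z + h * z\<^sup>2 * (\<kappa> + p - g')"
      using \<open>g' \<le> \<beta> - \<gamma>\<close> h0 by (intro add_left_mono mult_left_mono) (auto simp: beta_eq M_def)
    finally have "k < z + h * z\<^sup>2 * (\<kappa> + p - g')"
      using mult_pos_pos[OF h0 \<gamma>] unfolding k_def by linarith
    then have "r' < r * (z + h * z\<^sup>2 * (\<kappa> + p - g'))"
      unfolding r'_def using r0 by (intro mult_strict_left_mono)
    then have "persists r'"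
      using persists_step[OF r0(1) less_imp_le[OF r0(2)] h0 _ z_def g' _ _ r0(3), of r'] Mh \<open>s < r'\<close> s0 by auto
    then have "persists (min r' ((s + \<theta>) / 2))" by (rule persists_mono) simp
    moreover have "s < (s + \<theta>) / 2" "(s + \<theta>) / 2 < \<theta>" using s1 by simp_all
    ultimately have "min r' ((s + \<theta>) / 2) \<in> S" using \<open>s < r'\<close> s0 by (simp add: S_def min_less_iff_disj)
    then have "min r' ((s + \<theta>) / 2) \<le> s" unfolding s_def using bdd by (rule cSup_upper)
    then show False using \<open>s < r'\<close> \<open>s < (s + \<theta>) / 2\<close> by linarith
  qed
  then have "r < Sup S" using assms s_def by simp
  then obtain r1 where "r1 \<in> S" "r < r1" using less_cSup_iff[OF ne bdd] by blast
  then show ?thesis using persists_mono[of r1 r] by (auto simp: S_def)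
qed

lemma eventually_lower_bound_on_compact:
  assumes "compact K" "r < \<theta>"
  shows "\<forall>\<^sub>F t in at_top. 0 \<le> t \<and> (AE x in lebesgue. x \<in> K \<longrightarrow> r \<le> u t (x + t *\<^sub>R D))"
proof -
  obtain R where R: "\<And>x. x \<in> K \<Longrightarrow> norm x \<le> R"
    using compact_imp_bounded[OF assms(1)] by (auto simp: bounded_iff)
  obtain T where T: "0 \<le> T" "\<And>t. T \<le> t \<Longrightarrow> AE x in lebesgue. norm x \<le> R \<longrightarrow> r \<le> u t (x + t *\<^sub>R D)"
    using persists_below_theta[OF assms(2)] unfolding persists_def by blast
  show ?thesis
    using eventually_ge_at_top[of T]
  proof eventually_elim
    case (elim t)
    show ?case using T(1) elim R T(2)[OF elim] by (auto elim: eventually_mono)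
  qed
qed

lemma moving_frame_measurable:
  assumes "0 \<le> t" shows "(\<lambda>x. u t (x + t *\<^sub>R D)) \<in> borel_measurable lebesgue"
  using measurable_compose[OF measurable_lebesgue_shift(3) EplusD(3)[OF sol_range[OF assms]]] .

lemma ess_inf_on_tendsto:
  assumes K: "compact K" "0 < emeasure lebesgue K"
  shows "((\<lambda>t. ess_inf_on K (\<lambda>x. u t (x + t *\<^sub>R D))) \<longlongrightarrow> ereal \<theta>) at_top"
proof -
  have Ks: "K \<in> sets lebesgue" using K(1) by (simp add: borel_compact)
  define N where "N = restrict_space lebesgue K"
  have AE_N: "(AE x in N. P x) \<longleftrightarrow> (AE x in lebesgue. x \<in> K \<longrightarrow> P x)" for P
    unfolding N_def using Ks by (intro AE_restrict_space_iff) simp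
  have N0: "emeasure N (space N) \<noteq> 0"
    using K(2) Ks by (simp add: N_def emeasure_restrict_space space_restrict_space)
  have meas: "(\<lambda>x. - ereal (u t (x + t *\<^sub>R D))) \<in> borel_measurable N" if "0 \<le> t" for t
    unfolding N_def using moving_frame_measurable[OF that] by (intro measurable_restrict_space1) measurable
  have ge: "ereal r \<le> ess_inf_on K (\<lambda>x. u t (x + t *\<^sub>R D))"
    if "0 \<le> t" "AE x in lebesgue. x \<in> K \<longrightarrow> r \<le> u t (x + t *\<^sub>R D)" for t r
  proof -
    have "AE x in N. - ereal (u t (x + t *\<^sub>R D)) \<le> - ereal r"
      unfolding AE_N using that(2) by eventually_elim simp
    from esssup_I[OF meas[OF that(1)] this]
    show ?thesis unfolding ess_inf_on_def N_def[symmetric] by (metis ereal_minus_le_minus ereal_uminus_uminus)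
  qed
  have le: "ess_inf_on K (\<lambda>x. u t (x + t *\<^sub>R D)) \<le> ereal \<theta>" if "0 \<le> t" for t
  proof -
    have "AE x in N. - ereal \<theta> \<le> - ereal (u t (x + t *\<^sub>R D))"
      unfolding AE_N using AE_lebesgue_shift(3)[OF sol_AE_bounds[OF that], of "t *\<^sub>R D"] by eventually_elim simp
    then have "esssup N (\<lambda>x. - ereal \<theta>) \<le> esssup N (\<lambda>x. - ereal (u t (x + t *\<^sub>R D)))"
      by (intro esssup_AE_mono) auto
    then have "- ereal \<theta> \<le> esssup N (\<lambda>x. - ereal (u t (x + t *\<^sub>R D)))" using esssup_const[OF N0] by metis
    then show ?thesis unfolding ess_inf_on_def N_def[symmetric] by (metis ereal_minus_le_minus ereal_uminus_uminus)
  qed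
  show ?thesis
  proof (rule order_tendstoI)
    fix c assume "c < ereal \<theta>"
    then obtain r where r: "c < ereal r" "r < \<theta>" using ereal_dense2[of c "ereal \<theta>"] by auto
    show "\<forall>\<^sub>F t in at_top. c < ess_inf_on K (\<lambda>x. u t (x + t *\<^sub>R D))"
      using eventually_lower_bound_on_compact[OF K(1) r(2)]
      by eventually_elim (use ge r(1) less_le_trans in blast)
  next
    fix c assume c: "ereal \<theta> < c"
    show "\<forall>\<^sub>F t in at_top. ess_inf_on K (\<lambda>x. u t (x + t *\<^sub>R D)) < c"
      using eventually_ge_at_top[of 0]
    proof eventually_elim
      case (elim t)
      show ?case using le[OF elim] c by (rule le_less_trans)
    qed
  qed
qed

text \<open>
  For continuous functions the almost everywhere bound on a larger ball is a bound at every
  point of \<open>K\<close>, including null sets \<open>K\<close>.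
\<close>

lemma INF_tendsto:
  assumes K: "compact K" "K \<noteq> {}" and E: "E \<noteq> Linf"
  shows "((\<lambda>t. INF x\<in>K. u t (x + t *\<^sub>R D)) \<longlongrightarrow> \<theta>) at_top"
proof -
  obtain R where R: "\<And>x. x \<in> K \<Longrightarrow> norm x \<le> R"
    using compact_imp_bounded[OF K(1)] by (auto simp: bounded_iff)
  have cont: "continuous_on UNIV (\<lambda>x. u t (x + t *\<^sub>R D))" if "0 \<le> t" for t
    using space_of_continuous[OF EplusD(1)[OF sol_range[OF that]] E]
    by (rule continuous_on_compose2) (auto intro!: continuous_intros)
  have bounds: "0 \<le> u t (x + t *\<^sub>R D)" "u t (x + t *\<^sub>R D) \<le> \<theta>" if "0 \<le> t" for t x
    using AE_lebesgue_shift(3)[OF sol_AE_bounds[OF that], of "t *\<^sub>R D"]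
    by (auto intro!: AE_le_imp_le_continuous[OF _ cont[OF that], of "\<lambda>_. 0" x]
        AE_le_imp_le_continuous[OF cont[OF that], of "\<lambda>_. \<theta>" x])
  have le: "(INF x\<in>K. u t (x + t *\<^sub>R D)) \<le> \<theta>" if t: "0 \<le> t" for t
  proof -
    obtain x where "x \<in> K" using K(2) by blast
    then have "(INF x\<in>K. u t (x + t *\<^sub>R D)) \<le> u t (x + t *\<^sub>R D)"
      using bounds(1)[OF t] by (intro cINF_lower) (auto simp: bdd_below_def)
    then show ?thesis using bounds(2)[OF t, of x] by simp
  qed
  have ge: "\<forall>\<^sub>F t in at_top. r \<le> (INF x\<in>K. u t (x + t *\<^sub>R D))" if r: "0 \<le> r" "r < \<theta>" for r
    using eventually_lower_bound_on_compact[OF compact_cball[of 0 "R + 1"] r(2)]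
  proof eventually_elim
    case (elim t)
    \<comment> \<open>A continuous minorant of the solution that equals \<open>r\<close> on \<open>K\<close> and is not positive outside the ball of radius
      \<open>R + 1\<close>.\<close>
    define v where "v x = r * (1 - max 0 (norm x - R))" for x :: 'a
    have vc: "continuous_on UNIV v" unfolding v_def by (intro continuous_intros)
    have "AE x in lebesgue. v x \<le> u t (x + t *\<^sub>R D)"
      using conjunct2[OF elim]
    proof eventually_elim
      case (elim x)
      show ?case
      proof (cases "norm x \<le> R + 1")
        case True
        have "v x \<le> r" unfolding v_def using r by (intro mult_left_le) auto
        then show ?thesis using elim True by simp
      next
        case False
        have "v x \<le> 0" unfolding v_def using r False by (intro mult_nonneg_nonpos) auto
        then show ?thesis using bounds(1)[OF conjunct1[OF \<open>0 \<le> t \<and> _\<close>], of x] by linarith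
      qed
    qed
    then have "v x \<le> u t (x + t *\<^sub>R D)" for x
      using AE_le_imp_le_continuous[OF vc cont] elim by blast
    moreover have "v x = r" if "x \<in> K" for x using R[OF that] by (simp add: v_def)
    ultimately have "r \<le> u t (x + t *\<^sub>R D)" if "x \<in> K" for x using that by metis
    then show ?case using K(2) by (intro cINF_greatest) auto
  qed
  show ?thesis
  proof (rule order_tendstoI)
    fix c assume "c < \<theta>"
    define r where "r = (max c 0 + \<theta>) / 2"
    have r: "0 \<le> r" "c < r" "r < \<theta>" using \<open>c < \<theta>\<close> theta_pos by (auto simp: r_def)
    show "\<forall>\<^sub>F t in at_top. c < (INF x\<in>K. u t (x + t *\<^sub>R D))"
      using ge[OF r(1,3)] by eventually_elim (use r in linarith)
  next
    fix c assume c: "\<theta> < c"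
    show "\<forall>\<^sub>F t in at_top. (INF x\<in>K. u t (x + t *\<^sub>R D)) < c"
      using eventually_ge_at_top[of 0] by eventually_elim (use le c in \<open>auto intro: le_less_trans\<close>)
  qed
qed

end

theorem theorem2p5:
  fixes E :: space_kind
    and a u0 :: "real ^ 'd::finite \<Rightarrow> real"
    and G :: "(real ^ 'd \<Rightarrow> real) \<Rightarrow> (real ^ 'd \<Rightarrow> real)"
    and u :: "real \<Rightarrow> real ^ 'd \<Rightarrow> real"
    and m \<kappa> \<beta> \<theta> :: real
    and K :: "(real ^ 'd) set"
  assumes "m > 0" and "\<kappa> > 0"
    and a_nonneg: "AE x in lebesgue. 0 \<le> a x"
    and a_L1: "integrable lebesgue a"
    and a_mass: "(\<integral>x. a x \<partial>lebesgue) = 1"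
    and G_maps: "maps_space E G"
    and H1: "\<beta> = \<kappa> - m" "\<beta> > 0"
    and H2: "\<theta> > 0"
      "eq_in E (G (\<lambda>_. 0)) (\<lambda>_. 0)"
      "eq_in E (G (\<lambda>_. \<theta>)) (\<lambda>_. \<beta>)"
      "\<And>v. v \<in> Eplus E \<theta> \<Longrightarrow> le_in E (G (\<lambda>_. 0)) (G v) \<and> le_in E (G v) (G (\<lambda>_. \<theta>))"
    and H3: "\<exists>l>0. \<forall>v\<in>Eplus E \<theta>. \<forall>w\<in>Eplus E \<theta>.
      norm_in E (\<lambda>x. G v x - G w x) \<le> l * norm_in E (\<lambda>x. v x - w x)"
    and H4: "\<exists>p\<ge>0. \<forall>v\<in>Eplus E \<theta>. \<forall>w\<in>Eplus E \<theta>. le_in E v w \<longrightarrow>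
      le_in E (\<lambda>x. \<kappa> * conv a v x - v x * G v x + p * v x)
              (\<lambda>x. \<kappa> * conv a w x - w x * G w x + p * w x)"
    and H5: "\<exists>\<rho>>0. AE x in lebesgue. x \<in> ball 0 \<rho> \<longrightarrow> a x \<ge> \<rho>"
    and H6: "\<And>vn v. (\<And>n. vn n \<in> Eplus E \<theta>) \<Longrightarrow> v \<in> Eplus E \<theta> \<Longrightarrow> loc_unif_conv E vn v \<Longrightarrow>
      loc_unif_conv E (\<lambda>n. G (vn n)) (G v)"
    and H7: "\<And>v y. v \<in> Eplus E \<theta> \<Longrightarrow> eq_in E (translate y (G v)) (G (translate y v))"
    and H8: "\<And>r. 0 < r \<Longrightarrow> r < \<theta> \<Longrightarrow> forall_in E (\<lambda>x. G (\<lambda>_. r) x < \<beta>)"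
    and H9: "integrable lebesgue (\<lambda>y. norm y * a y)"
    and H10: "\<exists>q\<ge>0. \<exists>\<delta>>0. \<exists>b. (\<forall>x. 0 \<le> b x) \<and> smooth b \<and> b \<in> space_of Linf \<and>
      (AE x in lebesgue. a x - b x \<ge> \<delta> * indicator (ball 0 \<delta>) x) \<and>
      (\<forall>w\<in>Eplus E \<theta>. le_in E (\<lambda>x. w x * G w x) (\<lambda>x. \<kappa> * conv b w x + q * w x))"
    and u0: "u0 \<in> Eplus E \<theta>" "not_identically_zero E u0"
    and u_sol: "classical_solution E \<kappa> m a G u0 u"
    and u_range: "\<And>t. t \<ge> 0 \<Longrightarrow> u t \<in> Eplus E \<theta>"
    and K: "compact K"
  shows "(emeasure lebesgue K > 0 \<longrightarrow>
           ((\<lambda>t. ess_inf_on K (\<lambda>x. u t (x + t *\<^sub>R drift \<kappa> a))) \<longlongrightarrow> ereal \<theta>) at_top) \<and>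
         (E \<noteq> Linf \<and> K \<noteq> {} \<longrightarrow>
           ((\<lambda>t. INF x\<in>K. u t (x + t *\<^sub>R drift \<kappa> a)) \<longlongrightarrow> \<theta>) at_top)"

proof -
  obtain l where l: "0 < l" "\<And>v w. v \<in> Eplus E \<theta> \<Longrightarrow> w \<in> Eplus E \<theta> \<Longrightarrow>
      norm_in E (\<lambda>x. G v x - G w x) \<le> l * norm_in E (\<lambda>x. v x - w x)"
    using H3 by blast
  obtain p0 where p0: "0 \<le> p0" "\<And>v w. v \<in> Eplus E \<theta> \<Longrightarrow> w \<in> Eplus E \<theta> \<Longrightarrow> le_in E v w \<Longrightarrow>
      le_in E (\<lambda>x. \<kappa> * conv a v x - v x * G v x + p0 * v x)
              (\<lambda>x. \<kappa> * conv a w x - w x * G w x + p0 * w x)"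
    using H4 by blast
  obtain \<rho> where \<rho>: "0 < \<rho>" "AE x in lebesgue. x \<in> ball 0 \<rho> \<longrightarrow> a x \<ge> \<rho>" using H5 by blast
  obtain q \<delta> b where b: "0 < \<delta>" "\<And>x. 0 \<le> b x" "b \<in> space_of Linf"
    "AE x in lebesgue. a x - b x \<ge> \<delta> * indicator (ball 0 \<delta>) x"
    "\<And>w. w \<in> Eplus E \<theta> \<Longrightarrow> le_in E (\<lambda>x. w x * G w x) (\<lambda>x. \<kappa> * conv b w x + q * w x)"
    using H10 by blast
  define p where "p = max p0 (max q (l * \<theta>))"
  interpret hair_trigger E a u0 G u m \<kappa> \<theta> p \<beta> l q \<delta> \<rho> b
  proof
    fix v w :: "real ^ 'd \<Rightarrow> real" assume vw: "v \<in> Eplus E \<theta>" "w \<in> Eplus E \<theta>" "le_in E v w"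
    have "le_in E (\<lambda>x. \<kappa> * conv a v x - v x * G v x + p0 * v x + (p - p0) * v x)
              (\<lambda>x. \<kappa> * conv a w x - w x * G w x + p0 * w x + (p - p0) * w x)"
      using p0(2)[OF vw] vw(3) by (rule le_in_add_scaled) (simp add: p_def)
    then show "le_in E (\<lambda>x. \<kappa> * conv a v x - v x * G v x + p * v x)
              (\<lambda>x. \<kappa> * conv a w x - w x * G w x + p * w x)"
      by (simp add: algebra_simps)
  next
    show "0 \<le> p" using p0(1) by (simp add: p_def)
    show "q \<le> p" "l * \<theta> \<le> p" by (simp_all add: p_def)
    show "u0 \<in> space_of E" using u0(1) by (simp add: Eplus_def)
    show "b \<in> borel_measurable lebesgue" using b(3) by simp
    show "\<And>v. v \<in> space_of E \<Longrightarrow> G v \<in> space_of E" using G_maps by (simp add: maps_space_def)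
  qed (use assms(1-5) H1 H2 H6 H7 H8 H9 u0 u_sol u_range l \<rho> b in auto)
  show ?thesis
    using ess_inf_on_tendsto[OF K] INF_tendsto[OF K] by blast
qed

end
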